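(* Assume that for every finite bipartite dHp graph $H$ with sides $A_H$ and $B_H$ and every $X\subseteq A_H$ with $|X|\ge 2$ there is a cycle $C_X$ in $H$ with $V(C_X)\cap A_H=X$. Let $G$ be a countable bipartite graph with sides $A$ and $B$, both infinite, such that $G$ is a dHp graph and for each $v\in B$ either $\deg(v)=2$ or $N(v)=A$. Then there exists a cycle in $G$ (in the sense of circles in $|G|$) covering all the vertices of $A$.
   Context: For $X\subseteq V(G)$ with $|X|\ge 2$, $N^2(X)$ denotes the set of vertices of $G$ having at least two neighbours in $X$. A bipartite graph $G$ with sides $A$ and $B$ is a dHp graph if $|A|\ge 2$ and $|N^2(X)|\ge |X|$ for every $X\subseteq A$ with $|X|\ge 2$. Ends: a ray is a one-way infinite path; two rays are equivalent if for every finite $F\subset V(G)$ they have tails in the same component of $G\setminus F$; the equivalence classes are the ends, forming $\Omega(G)$. The space $|G|=G\cup\Omega(G)$ is topologized as follows: $G$ is viewed as a 1-complex (each edge a copy of $[0,1]$, vertices having open stars of radius $1/n$ as basic neighbourhoods), and for an end $\varepsilon$ and finite $F\subset V(G)$, letting $C(F,\varepsilon)$ be the component of $G\setminus F$ containing tails of the rays of $\varepsilon$, a basic open neighbourhood of $\varepsilon$ is $\Omega(F,\varepsilon)\cup C(F,\varepsilon)\cup E(F,\varepsilon)$, where $\Omega(F,\varepsilon)$ is the set of ends $\varepsilon'$ with $C(F,\varepsilon')=C(F,\varepsilon)$ and $E(F,\varepsilon)$ is the set of inner points of edges between $F$ and $C(F,\varepsilon)$. A circle is a subset of $|G|$ homeomorphic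 to $\mathbb{S}^1$; the cycle defined by a circle is the subgraph formed by the edges having an inner point in the circle together with their endvertices (finite cycles are cycles in this sense). A cycle covers $A$ if all vertices of $A$ lie on it. *)

theory Defs
  imports "HOL-Analysis.Analysis" "HOL-Library.Equipollence"
begin

text \<open>Graphs are simple and undirected, given by a vertex set \<open>V\<close> and a set \<open>E\<close> of edges, each
  edge being the two-element set of its endvertices.\<close>

definition nbrs :: "'a set set \<Rightarrow> 'a \<Rightarrow> 'a set" where
  "nbrs E v = {u. {u, v} \<in> E}"

definition bipartite_graph :: "'a set \<Rightarrow> 'a set \<Rightarrow> 'a set set \<Rightarrow> bool" where
  "bipartite_graph A B E \<longleftrightarrow> A \<inter> B = {} \<and> E \<subseteq> {{a, b} | a b. a \<in> A \<and> b \<in> B}"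

definition at_least_two :: "'a set \<Rightarrow> bool" where
  "at_least_two X \<longleftrightarrow> (\<exists>x\<in>X. \<exists>y\<in>X. x \<noteq> y)"

definition N2 :: "'a set \<Rightarrow> 'a set set \<Rightarrow> 'a set \<Rightarrow> 'a set" where
  "N2 V E X = {v \<in> V. at_least_two (nbrs E v \<inter> X)}"

text \<open>Sets \<open>X\<close> may be infinite, so \<open>|X| \<le> |N\<^sup>2(X)|\<close> is a comparison of cardinalities.\<close>

definition dHp_graph :: "'a set \<Rightarrow> 'a set \<Rightarrow> 'a set set \<Rightarrow> bool" where
  "dHp_graph A B E \<longleftrightarrow> bipartite_graph A B E \<and> at_least_two A \<and>
     (\<forall>X. X \<subseteq> A \<and> at_least_two X \<longrightarrow> X \<lesssim> N2 (A \<union> B) E X)"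

definition finite_cycle :: "'a set set \<Rightarrow> 'a list \<Rightarrow> bool" where
  "finite_cycle E c \<longleftrightarrow> 3 \<le> length c \<and> distinct c \<and>
     (\<forall>i < length c. {c ! i, c ! (Suc i mod length c)} \<in> E)"

subsection \<open>Ends\<close>

definition connected_in :: "'a set set \<Rightarrow> 'a set \<Rightarrow> ('a \<times> 'a) set" where
  "connected_in E W =
     {(u, v). u \<in> W \<and> v \<in> W \<and> (u, v) \<in> {(x, y). x \<in> W \<and> y \<in> W \<and> {x, y} \<in> E}\<^sup>*}"

text \<open>The vertex sets of the components of \<open>G \<setminus> F\<close>.\<close>

definition components_minus :: "'a set \<Rightarrow> 'a set set \<Rightarrow> 'a set \<Rightarrow> 'a set set" where
  "components_minus V E F = (V - F) // connected_in E (V - F)"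

definition rays :: "'a set set \<Rightarrow> (nat \<Rightarrow> 'a) set" where
  "rays E = {r. inj r \<and> (\<forall>n. {r n, r (Suc n)} \<in> E)}"

definition has_tail_in :: "(nat \<Rightarrow> 'a) \<Rightarrow> 'a set \<Rightarrow> bool" where
  "has_tail_in r C \<longleftrightarrow> (\<exists>k. r ` {k..} \<subseteq> C)"

definition ray_equiv :: "'a set \<Rightarrow> 'a set set \<Rightarrow> ((nat \<Rightarrow> 'a) \<times> (nat \<Rightarrow> 'a)) set" where
  "ray_equiv V E = {(r, s). r \<in> rays E \<and> s \<in> rays E \<and>
     (\<forall>F. finite F \<and> F \<subseteq> V \<longrightarrow>
        (\<exists>C \<in> components_minus V E F. has_tail_in r C \<and> has_tail_in s C))}"

definition ends :: "'a set \<Rightarrow> 'a set set \<Rightarrow> (nat \<Rightarrow> 'a) set set" where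
  "ends V E = rays E // ray_equiv V E"

definition end_component :: "'a set \<Rightarrow> 'a set set \<Rightarrow> 'a set \<Rightarrow> (nat \<Rightarrow> 'a) set \<Rightarrow> 'a set" where
  "end_component V E F \<epsilon> =
     (THE C. C \<in> components_minus V E F \<and> (\<forall>r\<in>\<epsilon>. has_tail_in r C))"

subsection \<open>The space \<open>|G|\<close>\<close>

text \<open>Points of the 1-complex are represented by their barycentric coordinates, so that no
  orientation of the edges has to be chosen: \<open>edge_pt u v t\<close> is the point at distance \<open>t\<close> from \<open>u\<close>
  on the edge \<open>{u, v}\<close>, and \<open>edge_pt u v t = edge_pt v u (1 - t)\<close>.\<close>

datatype 'a gpoint = Pt "'a \<Rightarrow> real" | End "(nat \<Rightarrow> 'a) set"

definition vertex_pt :: "'a \<Rightarrow> 'a gpoint" where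
  "vertex_pt v = Pt (\<lambda>x. if x = v then 1 else 0)"

definition edge_pt :: "'a \<Rightarrow> 'a \<Rightarrow> real \<Rightarrow> 'a gpoint" where
  "edge_pt u v t = Pt (\<lambda>x. if x = u then 1 - t else if x = v then t else 0)"

definition inner_pts :: "'a set \<Rightarrow> 'a gpoint set" where
  "inner_pts e = {edge_pt u v t | u v t. e = {u, v} \<and> 0 < t \<and> t < 1}"

definition open_star :: "'a set set \<Rightarrow> 'a \<Rightarrow> real \<Rightarrow> 'a gpoint set" where
  "open_star E v \<rho> = {vertex_pt v} \<union> {edge_pt v w t | w t. {v, w} \<in> E \<and> 0 < t \<and> t < \<rho>}"

definition end_nbhd :: "'a set \<Rightarrow> 'a set set \<Rightarrow> 'a set \<Rightarrow> (nat \<Rightarrow> 'a) set \<Rightarrow> 'a gpoint set" where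
  "end_nbhd V E F \<epsilon> = (let C = end_component V E F \<epsilon> in
     End ` {\<epsilon>' \<in> ends V E. end_component V E F \<epsilon>' = C}
     \<union> (vertex_pt ` C \<union> \<Union> (inner_pts ` {e \<in> E. e \<subseteq> C}))
     \<union> \<Union> (inner_pts ` {e \<in> E. \<exists>u\<in>F. \<exists>w\<in>C. e = {u, w}}))"

definition basic_opens :: "'a set \<Rightarrow> 'a set set \<Rightarrow> 'a gpoint set set" where
  "basic_opens V E =
     {open_star E v (1 / real n) | v n. v \<in> V \<and> 1 \<le> n}
     \<union> {edge_pt u v ` {a<..<b} | u v a b. {u, v} \<in> E \<and> 0 \<le> a \<and> a < b \<and> b \<le> 1}
     \<union> {end_nbhd V E F \<epsilon> | F \<epsilon>. finite F \<and> F \<subseteq> V \<and> \<epsilon> \<in> ends V E}"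

definition end_space :: "'a set \<Rightarrow> 'a set set \<Rightarrow> 'a gpoint topology" where
  "end_space V E = topology_generated_by (basic_opens V E)"

subsection \<open>Circles and cycles\<close>

definition is_circle :: "'a set \<Rightarrow> 'a set set \<Rightarrow> 'a gpoint set \<Rightarrow> bool" where
  "is_circle V E S \<longleftrightarrow> S \<subseteq> topspace (end_space V E) \<and>
     subtopology (end_space V E) S homeomorphic_space top_of_set (sphere (0::complex) 1)"

definition circle_edges :: "'a set set \<Rightarrow> 'a gpoint set \<Rightarrow> 'a set set" where
  "circle_edges E S = {e \<in> E. inner_pts e \<inter> S \<noteq> {}}"

text \<open>A cycle is a subgraph, i.e. a pair of a vertex set and an edge set.\<close>

definition is_cycle :: "'a set \<Rightarrow> 'a set set \<Rightarrow> 'a set \<times> 'a set set \<Rightarrow> bool" where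
  "is_cycle V E Z \<longleftrightarrow>
     (\<exists>S. is_circle V E S \<and> Z = (\<Union> (circle_edges E S), circle_edges E S))"

end

theory Submission
  imports Defs
begin

text \<open>Each vertex of \<open>B\<close> of degree two acts as an edge on \<open>A\<close>. If only finitely many vertices of \<open>B\<close> are
  adjacent to all of \<open>A\<close>, the dHp condition bounds the number of parts into which \<open>A\<close> falls after
  deleting a finite set \<open>F\<close>; taking \<open>F\<close> with the largest number of parts, no infinite part can be
  disconnected by a further finite deletion. (If infinitely many vertices of \<open>B\<close> are adjacent to all
  of \<open>A\<close>, the single part \<open>A\<close> has this property.) A finite cycle through \<open>F \<inter> A\<close> and through more than
  \<open>|F|\<close> vertices of each infinite part has, for each part \<open>D\<close>, two consecutive vertices of \<open>A\<close> in
  \<open>D\<close>. The vertex of \<open>B\<close> between them is replaced by two disjoint rays that exhaust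
  the rest of \<open>D\<close> and converge to the unique end of \<open>D\<close>. The result is a circular arrangement of
  finitely many double rays whose tails meet in distinct ends.\<close>

section \<open>Components and ends\<close>

text \<open>The circle must be exhibited as a subspace, and \<open>|G|\<close> need not be
  Hausdorff: a vertex adjacent to all of \<open>A\<close> cannot be separated from any end of
  \<open>G\<close>. Separation is therefore proved only between points of the circle. Longer and
  longer finite cycles need not converge to a circle either; since each infinite part has a single
  end, two rays may exhaust it in any order and still close up. The number of parts is bounded by a
  transversal: once \<open>F\<close> is deleted, a vertex of degree two meets at most one part, so
  only vertices adjacent to all of \<open>A\<close> have two neighbours in a set with one vertex
  from each part, and the dHp condition compares the size of this set with their number. If these
  vertices are finite in number, they are added to \<open>F\<close> together with the finite parts;
  then \<open>F\<close> separates the infinite parts from each other and tells their ends apart, as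
  injectivity of the circle requires. The vertices of \<open>B\<close> at which the cycle is cut may
  be lost, since only \<open>A\<close> has to be covered.\<close>

definition simple_graph :: "'a set \<Rightarrow> 'a set set \<Rightarrow> bool" where
  "simple_graph V E \<longleftrightarrow> (\<forall>u v. {u, v} \<in> E \<longrightarrow> u \<noteq> v \<and> u \<in> V \<and> v \<in> V)"

lemma equiv_connected_in: "equiv W (connected_in E W)"
proof (rule equivI)
  show "connected_in E W \<subseteq> W \<times> W" "refl_on W (connected_in E W)"
    by (auto simp: connected_in_def refl_on_def)
  have "sym {(x, y). x \<in> W \<and> y \<in> W \<and> {x, y} \<in> E}"
    by (auto simp: sym_def insert_commute)
  then have "sym ({(x, y). x \<in> W \<and> y \<in> W \<and> {x, y} \<in> E}\<^sup>*)" by (rule sym_rtrancl)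
  then show "sym (connected_in E W)"
    by (auto simp: connected_in_def sym_def)
  show "trans (connected_in E W)"
    by (auto simp: connected_in_def trans_def)
qed

lemma connected_in_edge: "u \<in> W \<Longrightarrow> v \<in> W \<Longrightarrow> {u, v} \<in> E \<Longrightarrow> (u, v) \<in> connected_in E W"
  by (auto simp: connected_in_def)

lemma connected_in_refl: "u \<in> W \<Longrightarrow> (u, u) \<in> connected_in E W"
  by (auto simp: connected_in_def)

lemma connected_in_trans:
  "(u, v) \<in> connected_in E W \<Longrightarrow> (v, w) \<in> connected_in E W \<Longrightarrow> (u, w) \<in> connected_in E W"
  by (auto simp: connected_in_def)

lemma connected_in_sym: "(u, v) \<in> connected_in E W \<Longrightarrow> (v, u) \<in> connected_in E W"
  using equiv_connected_in[of W E] by (auto simp: equiv_def sym_def)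

lemma connected_in_mono:
  assumes "W \<subseteq> W'" shows "connected_in E W \<subseteq> connected_in E W'"
proof -
  have "{(x, y). x \<in> W \<and> y \<in> W \<and> {x, y} \<in> E}\<^sup>* \<subseteq> {(x, y). x \<in> W' \<and> y \<in> W' \<and> {x, y} \<in> E}\<^sup>*"
    by (rule rtrancl_mono) (use assms in auto)
  then show ?thesis using assms by (auto simp: connected_in_def)
qed

lemma component_subset: "C \<in> components_minus V E F \<Longrightarrow> C \<subseteq> V - F"
  unfolding components_minus_def using equiv_connected_in
  by (rule in_quotient_imp_subset)

lemma component_closed:
  "C \<in> components_minus V E F \<Longrightarrow> x \<in> C \<Longrightarrow> (x, y) \<in> connected_in E (V - F) \<Longrightarrow> y \<in> C"
  unfolding components_minus_def using equiv_connected_in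
  by (rule in_quotient_imp_closed)

lemma component_unique:
  "C \<in> components_minus V E F \<Longrightarrow> C' \<in> components_minus V E F \<Longrightarrow> x \<in> C \<Longrightarrow> x \<in> C' \<Longrightarrow> C = C'"
  unfolding components_minus_def using quotient_disj[OF equiv_connected_in] by blast

lemma component_exists:
  assumes "x \<in> V - F" obtains C where "C \<in> components_minus V E F" "x \<in> C"
proof
  show "connected_in E (V - F) `` {x} \<in> components_minus V E F"
    unfolding components_minus_def using assms by (rule quotientI)
  show "x \<in> connected_in E (V - F) `` {x}"
    using connected_in_refl[OF assms] by auto
qed

lemma component_edge:
  assumes "C \<in> components_minus V E F" "simple_graph V E" "w \<in> C" "{w, u} \<in> E"
  shows "u \<in> C \<or> u \<in> F"
proof -
  have "w \<in> V - F" using component_subset[OF assms(1)] assms(3) by auto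
  moreover have "u \<in> V" using assms(2,4) by (auto simp: simple_graph_def)
  ultimately show ?thesis
    using component_closed[OF assms(1,3) connected_in_edge[OF _ _ assms(4)]] by blast
qed

lemma path_tail_in_component:
  assumes "C \<in> components_minus V E F" "simple_graph V E"
    "\<And>n. {r n, r (Suc n)} \<in> E" "\<And>n. n \<ge> k \<Longrightarrow> r n \<notin> F" "r k \<in> C" "n \<ge> k"
  shows "r n \<in> C"
  using \<open>n \<ge> k\<close>
proof (induction rule: dec_induct)
  case (step n)
  then show ?case using component_edge[OF assms(1,2) step.IH assms(3)] assms(4)[of "Suc n"] by auto
qed (rule assms(5))

lemma ray_eventually_avoids:
  assumes "inj r" "finite F"
  obtains k :: nat where "\<And>n. n \<ge> k \<Longrightarrow> r n \<notin> F"
proof -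
  have "finite (r -` F)" using assms by (intro finite_vimageI)
  then obtain k where "\<forall>n\<in>r -` F. n < k" using finite_nat_set_iff_bounded by blast
  then have "r n \<notin> F" if "n \<ge> k" for n using that by (meson not_le vimageI)
  then show ?thesis using that by blast
qed

lemma ray_tail_component:
  assumes "r \<in> rays E" "simple_graph V E" "finite F"
  obtains C where "C \<in> components_minus V E F" "has_tail_in r C"
proof -
  have r: "inj r" "\<And>n. {r n, r (Suc n)} \<in> E" using assms(1) by (auto simp: rays_def)
  obtain k where k: "\<And>n. n \<ge> k \<Longrightarrow> r n \<notin> F" using ray_eventually_avoids[OF r(1) assms(3)] by blast
  have "r k \<in> V - F" using k[of k] r(2)[of k] assms(2) by (auto simp: simple_graph_def)
  then obtain C where C: "C \<in> components_minus V E F" "r k \<in> C" by (rule component_exists)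
  have "has_tail_in r C"
    unfolding has_tail_in_def using path_tail_in_component[OF C(1) assms(2) r(2) k C(2)] by auto
  with C show ?thesis using that by blast
qed

lemma tails_meet:
  assumes "has_tail_in r C" "has_tail_in r C'" shows "\<exists>x. x \<in> C \<and> x \<in> C'"
proof -
  obtain k k' where "r ` {k..} \<subseteq> C" "r ` {k'..} \<subseteq> C'" using assms by (auto simp: has_tail_in_def)
  then have "r (max k k') \<in> C \<and> r (max k k') \<in> C'" by auto
  then show ?thesis by blast
qed

text \<open>For transitivity, the components given by the two hypotheses both contain a tail of the
  middle ray, so they meet and are equal.\<close>

lemma equiv_ray_equiv:
  assumes "simple_graph V E" shows "equiv (rays E) (ray_equiv V E)"
proof (rule equivI)
  show "ray_equiv V E \<subseteq> rays E \<times> rays E" by (auto simp: ray_equiv_def)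
  show "refl_on (rays E) (ray_equiv V E)"
    using ray_tail_component[OF _ assms] unfolding refl_on_def ray_equiv_def by blast
  show "sym (ray_equiv V E)" by (auto simp: sym_def ray_equiv_def)
  show "trans (ray_equiv V E)"
  proof (rule transI)
    fix r s t assume rs: "(r, s) \<in> ray_equiv V E" and st: "(s, t) \<in> ray_equiv V E"
    show "(r, t) \<in> ray_equiv V E"
      unfolding ray_equiv_def
    proof (safe)
      show "r \<in> rays E" "t \<in> rays E" using rs st by (auto simp: ray_equiv_def)
      fix F assume F: "finite F" "F \<subseteq> V"
      obtain C where C: "C \<in> components_minus V E F" "has_tail_in r C" "has_tail_in s C"
        using rs F unfolding ray_equiv_def by blast
      obtain C' where C': "C' \<in> components_minus V E F" "has_tail_in s C'" "has_tail_in t C'"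
        using st F unfolding ray_equiv_def by blast
      obtain x where "x \<in> C" "x \<in> C'" using tails_meet[OF C(3) C'(2)] by blast
      then have "C = C'" using component_unique C(1) C'(1) by metis
      then show "\<exists>C\<in>components_minus V E F. has_tail_in r C \<and> has_tail_in t C"
        using C C' by blast
    qed
  qed
qed

definition end_of :: "'a set \<Rightarrow> 'a set set \<Rightarrow> (nat \<Rightarrow> 'a) \<Rightarrow> (nat \<Rightarrow> 'a) set" where
  "end_of V E r = ray_equiv V E `` {r}"

lemma end_of_in_ends: "r \<in> rays E \<Longrightarrow> end_of V E r \<in> ends V E"
  unfolding ends_def end_of_def by (rule quotientI)

lemma end_of_eqI:
  "simple_graph V E \<Longrightarrow> (r, s) \<in> ray_equiv V E \<Longrightarrow> end_of V E r = end_of V E s"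
  unfolding end_of_def by (rule equiv_class_eq[OF equiv_ray_equiv])

text \<open>Makes the definite description in \<open>end_component\<close> usable: a component with
  a tail of one ray of the end has a tail of every ray of it, and two components with tails of the
  same ray coincide.\<close>

lemma end_component_end_of:
  assumes "simple_graph V E" "r \<in> rays E" "finite F" "F \<subseteq> V"
    "C \<in> components_minus V E F" "has_tail_in r C"
  shows "end_component V E F (end_of V E r) = C"
  unfolding end_component_def
proof (rule the_equality)
  have "has_tail_in s C" if rs: "(r, s) \<in> ray_equiv V E" for s
  proof -
    obtain C' where "C' \<in> components_minus V E F" "has_tail_in r C'" "has_tail_in s C'"
      using rs assms(3,4) unfolding ray_equiv_def by blast
    then show ?thesis using tails_meet[OF assms(6)] component_unique assms(5) by metis
  qed
  then show "C \<in> components_minus V E F \<and> (\<forall>s\<in>end_of V E r. has_tail_in s C)"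
    using assms(5) by (auto simp: end_of_def)
  fix C' assume C': "C' \<in> components_minus V E F \<and> (\<forall>s\<in>end_of V E r. has_tail_in s C')"
  have "r \<in> end_of V E r"
    using equiv_class_self[OF equiv_ray_equiv[OF assms(1)] assms(2)] by (simp add: end_of_def)
  then show "C' = C" using C' tails_meet[OF assms(6)] component_unique assms(5) by metis
qed

lemma end_component_is_component:
  assumes "simple_graph V E" "r \<in> rays E" "finite F" "F \<subseteq> V"
  shows "end_component V E F (end_of V E r) \<in> components_minus V E F"
    and "has_tail_in r (end_component V E F (end_of V E r))"
  using ray_tail_component[OF assms(2,1,3)] end_component_end_of[OF assms] by metis+

lemma end_component_in_components:
  assumes "simple_graph V E" "\<eta> \<in> ends V E" "finite F" "F \<subseteq> V"
  shows "end_component V E F \<eta> \<in> components_minus V E F"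
proof -
  obtain r where "r \<in> rays E" "\<eta> = end_of V E r"
    using assms(2) unfolding ends_def end_of_def by (auto elim: quotientE)
  then show ?thesis using end_component_is_component(1)[OF assms(1) _ assms(3,4)] by blast
qed

section \<open>Circles built from double rays\<close>

text \<open>The double ray \<open>p i\<close> leads from the end \<open>\<epsilon> i\<close>,
  approached as \<open>n\<close> decreases, to \<open>\<epsilon> (i + 1)\<close>, approached as
  \<open>n\<close> grows. Indices run over all integers with period \<open>m\<close>, so that
  closing up the circle is no special case; for \<open>m = 1\<close> there is one double ray with
  both tails in the same end. The finite set \<open>F0\<close> distinguishes the \<open>m\<close>
  ends, and so does every finite superset, which leaves room for enlarging it when neighbourhoods
  are to be separated.\<close>

locale double_ray_circle =
  fixes V :: "'a set" and E :: "'a set set" and m :: int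
    and p :: "int \<Rightarrow> int \<Rightarrow> 'a" and \<epsilon> :: "int \<Rightarrow> (nat \<Rightarrow> 'a) set" and F0 :: "'a set"
  assumes simple: "simple_graph V E"
    and m_pos: "m > 0"
    and p_inj: "p i n = p j n' \<Longrightarrow> n = n' \<and> m dvd i - j"
    and p_periodic: "p (i + m) = p i"
    and p_edge: "{p i n, p i (n + 1)} \<in> E"
    and eps_ends: "\<epsilon> i \<in> ends V E"
    and eps_periodic: "\<epsilon> (i + m) = \<epsilon> i"
    and right_tail:
      "finite F \<Longrightarrow> F \<subseteq> V \<Longrightarrow> \<exists>N. \<forall>n\<ge>N. p i n \<in> end_component V E F (\<epsilon> (i + 1))"
    and left_tail:
      "finite F \<Longrightarrow> F \<subseteq> V \<Longrightarrow> \<exists>N. \<forall>n\<le>N. p i n \<in> end_component V E F (\<epsilon> i)"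
    and F0: "finite F0" "F0 \<subseteq> V"
    and F0_separates:
      "finite F \<Longrightarrow> F0 \<subseteq> F \<Longrightarrow> F \<subseteq> V \<Longrightarrow>
        end_component V E F (\<epsilon> i) = end_component V E F (\<epsilon> j) \<Longrightarrow> m dvd i - j"
begin

lemma p_V: "p i n \<in> V"
  using simple p_edge by (auto simp: simple_graph_def)

lemma p_neq: "n \<noteq> n' \<Longrightarrow> p i n \<noteq> p j n'"
  using p_inj by blast

lemma p_mult: "p (i + k * m) = p i"
proof (induction k rule: int_induct[where k = 0])
  case (step1 k) 
  have "p (i + (k + 1) * m) = p (i + k * m + m)" by (simp add: algebra_simps)
  then show ?case using step1 p_periodic by simp
next
  case (step2 k)
  have "p (i + k * m) = p (i + (k - 1) * m + m)" by (simp add: algebra_simps)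
  then show ?case using step2 p_periodic by simp
qed simp

lemma p_cong: "m dvd i - j \<Longrightarrow> p i = p j"
  using p_mult[of j] by (auto simp: dvd_def algebra_simps)

lemma eps_mult: "\<epsilon> (i + k * m) = \<epsilon> i"
proof (induction k rule: int_induct[where k = 0])
  case (step1 k) 
  have "\<epsilon> (i + (k + 1) * m) = \<epsilon> (i + k * m + m)" by (simp add: algebra_simps)
  then show ?case using step1 eps_periodic by simp
next
  case (step2 k)
  have "\<epsilon> (i + k * m) = \<epsilon> (i + (k - 1) * m + m)" by (simp add: algebra_simps)
  then show ?case using step2 eps_periodic by simp
qed simp

section \<open>Real coordinates along the double rays\<close>

definition line :: "int \<Rightarrow> real \<Rightarrow> 'a gpoint" where
  "line i x = edge_pt (p i \<lfloor>x\<rfloor>) (p i (\<lfloor>x\<rfloor> + 1)) (frac x)"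

text \<open>The barycentric coordinates of \<open>line i x\<close>: where positive, the value at
  \<open>p i n\<close> is the tent function \<open>1 - \<bar>x - n\<bar>\<close>. The integer case
  is split off so that unfolding also tells whether the point is a vertex.\<close>

definition hat :: "int \<Rightarrow> real \<Rightarrow> 'a \<Rightarrow> real" where
  "hat i x z = (if x = \<lfloor>x\<rfloor> then (if z = p i \<lfloor>x\<rfloor> then 1 else 0) else
     if z = p i \<lfloor>x\<rfloor> then 1 - frac x else if z = p i (\<lfloor>x\<rfloor> + 1) then frac x else 0)"

lemma line_eq_hat: "line i x = Pt (hat i x)"
  using p_neq[of "\<lfloor>x\<rfloor>" "\<lfloor>x\<rfloor> + 1" i i]
  by (auto simp: line_def edge_pt_def hat_def fun_eq_iff frac_def)

lemma hat_pos:
  assumes "hat i x z > 0"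
  obtains n where "z = p i n" "\<bar>x - n\<bar> < 1" "hat i x z = 1 - \<bar>x - n\<bar>"
proof (cases "z = p i \<lfloor>x\<rfloor>")
  case True
  then have "hat i x z = 1 - \<bar>x - \<lfloor>x\<rfloor>\<bar>" by (simp add: hat_def frac_def)
  moreover have "\<bar>x - \<lfloor>x\<rfloor>\<bar> < 1" by linarith
  ultimately show ?thesis using that[OF True] by blast
next
  case False
  then have z: "z = p i (\<lfloor>x\<rfloor> + 1)" and x: "x \<noteq> \<lfloor>x\<rfloor>" and h: "hat i x z = frac x"
    using assms by (simp_all add: hat_def split: if_splits)
  have "\<bar>x - of_int (\<lfloor>x\<rfloor> + 1)\<bar> < 1" "frac x = 1 - \<bar>x - of_int (\<lfloor>x\<rfloor> + 1)\<bar>"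
    using x unfolding frac_def by linarith+
  then show ?thesis using that[OF z] h by simp
qed

lemma line_int: "line i (of_int n) = vertex_pt (p i n)"
  by (simp add: line_eq_hat vertex_pt_def hat_def fun_eq_iff)

lemma line_right: "0 \<le> t \<Longrightarrow> t < 1 \<Longrightarrow> line i (of_int n + t) = edge_pt (p i n) (p i (n + 1)) t"
proof -
  assume t: "0 \<le> t" "t < 1"
  then have "\<lfloor>of_int n + t\<rfloor> = n" by linarith
  then show ?thesis by (simp add: line_def frac_def)
qed

lemma edge_pt_swap: "u \<noteq> v \<Longrightarrow> edge_pt u v t = edge_pt v u (1 - t)"
  by (auto simp: edge_pt_def fun_eq_iff)

lemma line_left:
  assumes "0 < t" "t < 1" shows "line i (of_int n - t) = edge_pt (p i n) (p i (n - 1)) t"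
proof -
  have "line i (of_int (n - 1) + (1 - t)) = edge_pt (p i (n - 1)) (p i n) (1 - t)"
    using line_right[of "1 - t" i "n - 1"] assms by simp
  also have "\<dots> = edge_pt (p i n) (p i (n - 1)) t"
    using edge_pt_swap[OF p_neq[of n "n - 1" i i]] by simp
  finally show ?thesis by simp
qed

text \<open>A point in the star of radius \<rho> has coordinate above 1 - \<rho> at the centre. As
  \<rho> is at most 1, this coordinate is positive, and \<open>hat_pos\<close> converts it into a
  distance on the real line.\<close>

lemma line_in_star_iff:
  assumes "0 < \<rho>" "\<rho> \<le> 1"
  shows "line i x \<in> open_star E v \<rho> \<longleftrightarrow> (\<exists>n. v = p i n \<and> \<bar>x - n\<bar> < \<rho>)"
proof
  assume "line i x \<in> open_star E v \<rho>"
  then have "hat i x v > 1 - \<rho>"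
    using assms simple
    by (auto simp: line_eq_hat open_star_def vertex_pt_def edge_pt_def simple_graph_def)
  moreover from this obtain n where "v = p i n" "hat i x v = 1 - \<bar>x - n\<bar>"
    using hat_pos[of i x v] assms by (metis diff_ge_0_iff_ge le_less_trans)
  ultimately show "\<exists>n. v = p i n \<and> \<bar>x - n\<bar> < \<rho>" by force
next
  assume "\<exists>n. v = p i n \<and> \<bar>x - n\<bar> < \<rho>"
  then obtain n where n: "v = p i n" "\<bar>x - n\<bar> < \<rho>" by blast
  consider "x = n" | "x > n" | "x < n" by linarith
  then show "line i x \<in> open_star E v \<rho>"
  proof cases
    case 1 then show ?thesis using n line_int by (simp add: open_star_def)
  next
    case 2
    then have "line i x = edge_pt v (p i (n + 1)) (x - n)"
      using line_right[of "x - n" i n] n assms by auto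
    then show ?thesis using 2 n p_edge[of i n] by (auto simp: open_star_def)
  next
    case 3
    then have "line i x = edge_pt v (p i (n - 1)) (n - x)"
      using line_left[of "n - x" i n] n assms by auto
    moreover have "{v, p i (n - 1)} \<in> E" using p_edge[of i "n - 1"] n by (simp add: insert_commute)
    ultimately show ?thesis using 3 n by (auto simp: open_star_def)
  qed
qed

text \<open>The two cases are the two directions in which the line may run through the edge: an
  inner point of an edge determines the edge and its coordinates, but not the order of the
  endvertices.\<close>

lemma line_eq_edge_pt:
  assumes "u \<noteq> v" "0 < t" "t < 1" "line i x = edge_pt u v t"
  obtains "x \<noteq> \<lfloor>x\<rfloor>" "u = p i \<lfloor>x\<rfloor>" "v = p i (\<lfloor>x\<rfloor> + 1)" "t = frac x"
  | "x \<noteq> \<lfloor>x\<rfloor>" "v = p i \<lfloor>x\<rfloor>" "u = p i (\<lfloor>x\<rfloor> + 1)" "t = 1 - frac x"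
proof -
  have eq: "hat i x z = (if z = u then 1 - t else if z = v then t else 0)" for z
    using assms(4) by (simp add: line_eq_hat edge_pt_def)
  have "hat i x u = 1 - t" "hat i x v = t" using eq[of u] eq[of v] assms(1) by auto
  then have "x \<noteq> \<lfloor>x\<rfloor> \<and> (u = p i \<lfloor>x\<rfloor> \<and> v = p i (\<lfloor>x\<rfloor> + 1) \<and> t = frac x \<or>
      v = p i \<lfloor>x\<rfloor> \<and> u = p i (\<lfloor>x\<rfloor> + 1) \<and> t = 1 - frac x)"
    using assms(1-3) by (simp add: hat_def split: if_splits)
  then show ?thesis using that by blast
qed

lemma line_in_inner_iff:
  assumes "e \<in> E"
  shows "line i x \<in> inner_pts e \<longleftrightarrow> x \<noteq> \<lfloor>x\<rfloor> \<and> e = {p i \<lfloor>x\<rfloor>, p i (\<lfloor>x\<rfloor> + 1)}"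
proof
  assume "line i x \<in> inner_pts e"
  then obtain u v t where e: "e = {u, v}" "0 < t" "t < 1" "line i x = edge_pt u v t"
    by (auto simp: inner_pts_def)
  then have "u \<noteq> v" using assms simple by (auto simp: simple_graph_def)
  from this e(2-4) show "x \<noteq> \<lfloor>x\<rfloor> \<and> e = {p i \<lfloor>x\<rfloor>, p i (\<lfloor>x\<rfloor> + 1)}"
    by (rule line_eq_edge_pt) (use e in auto)
next
  assume *: "x \<noteq> \<lfloor>x\<rfloor> \<and> e = {p i \<lfloor>x\<rfloor>, p i (\<lfloor>x\<rfloor> + 1)}"
  then have "0 < frac x" "frac x < 1" unfolding frac_def by linarith+
  then show "line i x \<in> inner_pts e"
    using * unfolding inner_pts_def line_def mem_Collect_eq by (intro exI conjI) auto
qed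

text \<open>An edge with one endvertex in the component \<open>C\<close> has the other one in
  \<open>C\<close> or in \<open>F\<close>. In both cases all its inner points belong to the
  neighbourhood, so membership depends only on the vertices next to \<open>x\<close>.\<close>

lemma line_in_end_nbhd_iff:
  fixes \<eta> assumes "finite F" "F \<subseteq> V" "\<eta> \<in> ends V E"
  defines "C \<equiv> end_component V E F \<eta>"
  shows "line i x \<in> end_nbhd V E F \<eta> \<longleftrightarrow>
    p i \<lfloor>x\<rfloor> \<in> C \<or> x \<noteq> \<lfloor>x\<rfloor> \<and> p i (\<lfloor>x\<rfloor> + 1) \<in> C"
    (is "?L \<longleftrightarrow> ?R")
proof -
  have C: "C \<in> components_minus V E F" unfolding C_def
      by (rule end_component_in_components[OF simple assms(3,1,2)])
  let ?e = "{p i \<lfloor>x\<rfloor>, p i (\<lfloor>x\<rfloor> + 1)}"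
  have vert: "line i x \<in> vertex_pt ` C \<longleftrightarrow> x = \<lfloor>x\<rfloor> \<and> p i \<lfloor>x\<rfloor> \<in> C"
  proof
    assume "line i x \<in> vertex_pt ` C"
    then obtain v where v: "v \<in> C" "line i x = vertex_pt v" by blast
    have "hat i x v = 1" using v by (simp add: line_eq_hat vertex_pt_def)
    moreover from this obtain n where "v = p i n" "hat i x v = 1 - \<bar>x - n\<bar>"
      using hat_pos[of i x v] by (metis zero_less_one)
    ultimately have "v = p i n" "x = n" by simp_all
    then show "x = \<lfloor>x\<rfloor> \<and> p i \<lfloor>x\<rfloor> \<in> C" using v by simp
  next
    assume "x = \<lfloor>x\<rfloor> \<and> p i \<lfloor>x\<rfloor> \<in> C"
    then show "line i x \<in> vertex_pt ` C" using line_int[of i "\<lfloor>x\<rfloor>"] by auto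
  qed
  have "line i x \<notin> End ` Y" for Y by (auto simp: line_eq_hat)
  then have mem: "?L \<longleftrightarrow> line i x \<in> vertex_pt ` C
      \<or> (\<exists>e\<in>E. (e \<subseteq> C \<or> (\<exists>u\<in>F. \<exists>w\<in>C. e = {u, w})) \<and> line i x \<in> inner_pts e)"
    unfolding end_nbhd_def Let_def C_def[symmetric] by blast
  have ends: "?e \<subseteq> C \<or> (\<exists>u\<in>F. \<exists>w\<in>C. ?e = {u, w}) \<longleftrightarrow> p i \<lfloor>x\<rfloor> \<in> C \<or> p i (\<lfloor>x\<rfloor> + 1) \<in> C"
  proof
    assume "p i \<lfloor>x\<rfloor> \<in> C \<or> p i (\<lfloor>x\<rfloor> + 1) \<in> C"
    then show "?e \<subseteq> C \<or> (\<exists>u\<in>F. \<exists>w\<in>C. ?e = {u, w})"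
    proof
      assume a: "p i \<lfloor>x\<rfloor> \<in> C"
      show ?thesis using component_edge[OF C simple a p_edge] a by (auto simp: doubleton_eq_iff)
    next
      assume a: "p i (\<lfloor>x\<rfloor> + 1) \<in> C"
      have "{p i (\<lfloor>x\<rfloor> + 1), p i \<lfloor>x\<rfloor>} \<in> E" using p_edge[of i "\<lfloor>x\<rfloor>"] by (simp add: insert_commute)
      from component_edge[OF C simple a this] a show ?thesis by (auto simp: doubleton_eq_iff)
    qed
  qed (auto simp: doubleton_eq_iff)
  have "(\<exists>e\<in>E. (e \<subseteq> C \<or> (\<exists>u\<in>F. \<exists>w\<in>C. e = {u, w})) \<and> line i x \<in> inner_pts e) \<longleftrightarrow>
      x \<noteq> \<lfloor>x\<rfloor> \<and> (?e \<subseteq> C \<or> (\<exists>u\<in>F. \<exists>w\<in>C. ?e = {u, w}))"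
    using p_edge[of i "\<lfloor>x\<rfloor>"] by (auto simp: line_in_inner_iff)
  then show ?thesis unfolding mem vert ends by blast
qed


section \<open>Continuity along the lines and at the ends\<close>

lemma basic_open_cases:
  assumes "U \<in> basic_opens V E"
  obtains v \<rho> where "0 < \<rho>" "\<rho> \<le> 1" "U = open_star E v \<rho>"
  | u v a b where "{u, v} \<in> E" "0 \<le> a" "a < b" "b \<le> 1" "U = edge_pt u v ` {a<..<b}"
  | F \<eta> where "finite F" "F \<subseteq> V" "\<eta> \<in> ends V E" "U = end_nbhd V E F \<eta>"
  using assms unfolding basic_opens_def
proof (elim UnE CollectE exE conjE)
  fix v and n :: nat assume "U = open_star E v (1 / real n)" "1 \<le> n"
  then show ?thesis using that(1)[of "1 / real n" v] by simp
qed (use that in blast)+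

text \<open>Continuity of each line at a real point, tested on the generating open sets
  only.\<close>

lemma line_nbhd_in_basic:
  assumes "U \<in> basic_opens V E" "line i x \<in> U"
  shows "\<forall>\<^sub>F y in nhds x. line i y \<in> U"
  using assms(1)
proof (cases rule: basic_open_cases)
  case (1 v \<rho>)
  then obtain n where n: "v = p i n" "\<bar>x - of_int n\<bar> < \<rho>" using assms(2) line_in_star_iff by blast
  have "open {y. \<bar>y - of_int n\<bar> < \<rho>}" by (intro open_Collect_less continuous_intros)
  then have "\<forall>\<^sub>F y in nhds x. y \<in> {y. \<bar>y - of_int n\<bar> < \<rho>}"
      by (rule eventually_nhds_in_open) (simp add: n)
  then show ?thesis by eventually_elim (use 1 n line_in_star_iff in auto)
next
  case (2 u v a b)
  then obtain t where t: "a < t" "t < b" "line i x = edge_pt u v t" using assms(2) by auto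
  have "u \<noteq> v" using 2 simple by (auto simp: simple_graph_def)
  let ?n = "\<lfloor>x\<rfloor>"
  have "0 < t" "t < 1" using t 2 by auto
  with \<open>u \<noteq> v\<close> show ?thesis using t(3)
  proof (cases rule: line_eq_edge_pt)
    case 1
    have "open {of_int ?n + a<..<of_int ?n + b}" by simp
    then have "\<forall>\<^sub>F y in nhds x. y \<in> {of_int ?n + a<..<of_int ?n + b}"
      by (rule eventually_nhds_in_open) (use 1 t in \<open>simp add: frac_def\<close>)
    then show ?thesis
    proof eventually_elim
      case (elim y)
      then have "line i (of_int ?n + (y - ?n)) = edge_pt u v (y - ?n)"
        using 1 2 by (subst line_right) auto
      then show ?case using elim 2 by auto
    qed
  next
    case b: 2
    \<comment> \<open>The line runs against the orientation of the basic set, which turns the bounds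
      \<open>a\<close> and \<open>b\<close> into \<open>1 - b\<close> and
      \<open>1 - a\<close>.\<close>
    have "open {of_int ?n + (1 - b)<..<of_int ?n + (1 - a)}" by simp
    then have "\<forall>\<^sub>F y in nhds x. y \<in> {of_int ?n + (1 - b)<..<of_int ?n + (1 - a)}"
      by (rule eventually_nhds_in_open) (use b t in \<open>simp add: frac_def\<close>)
    then show ?thesis
    proof eventually_elim
      case (elim y)
      then have "line i (of_int ?n + (y - ?n)) = edge_pt v u (y - ?n)"
        using b 2 by (subst line_right) auto
      then have "line i y = edge_pt u v (1 - (y - ?n))"
        using edge_pt_swap[OF \<open>u \<noteq> v\<close>, of "1 - (y - ?n)"] by simp
      moreover have "1 - (y - ?n) \<in> {a<..<b}" using elim by simp
      ultimately show ?case using 2 by blast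
    qed
  qed
next
  case (3 F \<eta>)
  define C where "C = end_component V E F \<eta>"
  note iff = line_in_end_nbhd_iff[OF 3(1-3), folded C_def 3(4)]
  show ?thesis
  proof (cases "x = \<lfloor>x\<rfloor>")
    case True
    have "open {x - 1<..<x + 1}" by simp
    then have "\<forall>\<^sub>F y in nhds x. y \<in> {x - 1<..<x + 1}" by (rule eventually_nhds_in_open) simp
    then show ?thesis
    proof eventually_elim
      case (elim y)
      have "p i \<lfloor>x\<rfloor> \<in> C" using assms(2) iff True by blast
      \<comment> \<open>Within distance 1 of a vertex, a point of the line is that vertex or lies on
        one of the two line edges at it.\<close>
      moreover have "\<lfloor>y\<rfloor> = \<lfloor>x\<rfloor> \<or> y \<noteq> \<lfloor>y\<rfloor> \<and> \<lfloor>y\<rfloor> + 1 = \<lfloor>x\<rfloor>"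
        using elim True by (simp; linarith)
      ultimately show ?case using iff by auto
    qed
  next
    case False
    have "open {of_int \<lfloor>x\<rfloor><..<of_int \<lfloor>x\<rfloor> + 1 :: real}" by simp
    then have "\<forall>\<^sub>F y in nhds x. y \<in> {of_int \<lfloor>x\<rfloor><..<of_int \<lfloor>x\<rfloor> + 1}"
      by (rule eventually_nhds_in_open) (use False in \<open>simp; linarith\<close>)
    then show ?thesis
    proof eventually_elim
      case (elim y)
      then have "\<lfloor>y\<rfloor> = \<lfloor>x\<rfloor>" by (simp; linarith)
      moreover from this have "y \<noteq> \<lfloor>y\<rfloor>" using elim by simp
      ultimately show ?case using iff assms(2) by auto
    qed
  qed
qed

text \<open>Continuity at an end: it is approached along line \<open>i\<close> towards minus
  infinity and along line \<open>i - 1\<close> towards plus infinity.\<close>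

lemma end_nbhd_tails:
  assumes "U \<in> basic_opens V E" "End (\<epsilon> i) \<in> U"
  shows "\<forall>\<^sub>F y in at_bot. line i y \<in> U" "\<forall>\<^sub>F y in at_top. line (i - 1) y \<in> U"
proof -
  have "\<exists>F \<eta>. finite F \<and> F \<subseteq> V \<and> \<eta> \<in> ends V E \<and> U = end_nbhd V E F \<eta>"
    using assms(1)
    by (cases rule: basic_open_cases)
      (use assms(2) in \<open>auto simp: open_star_def edge_pt_def vertex_pt_def\<close>)
  then obtain F \<eta> where F: "finite F" "F \<subseteq> V" "\<eta> \<in> ends V E" "U = end_nbhd V E F \<eta>" by blast
  define C where "C = end_component V E F \<eta>"
  note iff = line_in_end_nbhd_iff[OF F(1-3), folded C_def F(4)]
  \<comment> \<open>The neighbourhood may be written with another end \<eta>; that it contains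
    \<open>\<epsilon> i\<close> means that both ends select the same component.\<close>
  have C: "end_component V E F (\<epsilon> i) = C"
    using assms(2) unfolding F(4) end_nbhd_def Let_def C_def[symmetric]
    by (auto simp: inner_pts_def edge_pt_def vertex_pt_def)
  obtain N where N: "\<And>n. n \<le> N \<Longrightarrow> p i n \<in> C" using left_tail[OF F(1,2), of i] C by blast
  show "\<forall>\<^sub>F y in at_bot. line i y \<in> U"
    using eventually_le_at_bot[of "of_int N"]
  proof eventually_elim
    case (elim y)
    then have "\<lfloor>y\<rfloor> \<le> N" by linarith
    then show ?case using iff N by blast
  qed
  obtain N' where N': "\<And>n. n \<ge> N' \<Longrightarrow> p (i - 1) n \<in> C" using right_tail[OF F(1,2), of "i - 1"] C
      by auto
  show "\<forall>\<^sub>F y in at_top. line (i - 1) y \<in> U"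
    using eventually_ge_at_top[of "of_int N'"]
  proof eventually_elim
    case (elim y)
    then have "\<lfloor>y\<rfloor> \<ge> N'" by linarith
    then show ?case using iff N' by blast
  qed
qed

section \<open>Neighbourhoods separating the points of the circle\<close>

lemma line_separating_open:
  assumes "\<delta> > 0"
  obtains U where "U \<in> basic_opens V E" "line i x \<in> U" "\<And>\<eta>. End \<eta> \<notin> U"
    "\<And>j y. line j y \<in> U \<Longrightarrow> m dvd i - j \<and> \<bar>x - y\<bar> < \<delta>"
proof (cases "x = \<lfloor>x\<rfloor>")
  case True
  obtain n :: nat where n: "n > 0" "1 / n < \<delta>" using assms
      by (metis nat_approx_posE of_nat_Suc zero_less_Suc)
  let ?U = "open_star E (p i \<lfloor>x\<rfloor>) (1 / n)"
  show ?thesis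
  proof
    show "?U \<in> basic_opens V E" using n p_V unfolding basic_opens_def by fastforce
    show "line i x \<in> ?U" using True n by (subst line_in_star_iff) auto
    show "End \<eta> \<notin> ?U" for \<eta> by (auto simp: open_star_def vertex_pt_def edge_pt_def)
    fix j y assume "line j y \<in> ?U"
    then obtain k where "p i \<lfloor>x\<rfloor> = p j k" "\<bar>y - of_int k\<bar> < 1 / n" using n
        by (subst (asm) line_in_star_iff) auto
    then have "k = \<lfloor>x\<rfloor>" "m dvd i - j" "\<bar>y - of_int k\<bar> < \<delta>" using p_inj[of i "\<lfloor>x\<rfloor>" j k] n by auto
    then show "m dvd i - j \<and> \<bar>x - y\<bar> < \<delta>" using True by (simp add: abs_minus_commute)
  qed
next
  case False
  \<comment> \<open>The segment of radius \<delta> around the point is clipped to its edge.\<close>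
  define a b where "a = max 0 (frac x - \<delta>)" and "b = min 1 (frac x + \<delta>)"
  have fr: "0 < frac x" "frac x < 1" using False unfolding frac_def by linarith+
  have ab: "0 \<le> a" "a < frac x" "frac x < b" "b \<le> 1" using fr assms by (auto simp: a_def b_def)
  let ?u = "p i \<lfloor>x\<rfloor>" and ?v = "p i (\<lfloor>x\<rfloor> + 1)"
  let ?U = "edge_pt ?u ?v ` {a<..<b}"
  show ?thesis
  proof
    have "a < b" using ab by linarith
    then show "?U \<in> basic_opens V E" using ab p_edge unfolding basic_opens_def by blast
    show "line i x \<in> ?U" using ab unfolding line_def by auto
    show "End \<eta> \<notin> ?U" for \<eta> by (auto simp: edge_pt_def)
    fix j y assume "line j y \<in> ?U"
    then obtain t where t: "a < t" "t < b" "line j y = edge_pt ?u ?v t" by auto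
    have "?u \<noteq> ?v" "0 < t" "t < 1" using t ab p_neq by auto
    from this t(3) show "m dvd i - j \<and> \<bar>x - y\<bar> < \<delta>"
    proof (cases rule: line_eq_edge_pt)
      case 1
      then have "\<lfloor>x\<rfloor> = \<lfloor>y\<rfloor>" "m dvd i - j" using p_inj by blast+
      moreover have "\<bar>frac x - frac y\<bar> < \<delta>" using t 1 by (auto simp: a_def b_def abs_less_iff)
      ultimately show ?thesis by (simp add: frac_def)
    next
      case 2
      \<comment> \<open>The reverse direction is contradictory, since a vertex determines its
        position on every line through it.\<close>
      then have "\<lfloor>x\<rfloor> = \<lfloor>y\<rfloor> + 1" "\<lfloor>x\<rfloor> + 1 = \<lfloor>y\<rfloor>" using p_inj by blast+
      then show ?thesis by simp
    qed
  qed
qed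

text \<open>By \<open>p_inj\<close> a vertex occurs at one position \<open>n\<close> only, whichever
  index \<open>j\<close> is used. Finitely many vertices thus occupy finitely many positions,
  uniformly in \<open>j\<close>.\<close>

lemma finite_set_meets_lines_boundedly:
  assumes "finite F" obtains M :: int where "\<And>j n. p j n \<in> F \<Longrightarrow> \<bar>n\<bar> \<le> M"
proof -
  have "\<exists>k. \<forall>j n. p j n = v \<longrightarrow> n = k" for v
    using p_inj by metis
  then obtain k where k: "\<And>v j n. p j n = v \<Longrightarrow> n = k v" by metis
  have "\<bar>n\<bar> \<le> Max (insert 0 ((\<lambda>v. \<bar>k v\<bar>) ` F))" if "p j n \<in> F" for j n
  proof (rule Max_ge)
    have "n = k (p j n)" by (rule k[OF refl])
    then show "\<bar>n\<bar> \<in> insert 0 ((\<lambda>v. \<bar>k v\<bar>) ` F)" using that by (metis image_eqI insertCI)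
  qed (use assms in simp)
  then show ?thesis using that by blast
qed

text \<open>Besides \<open>F0\<close>, a long middle segment of every double ray is deleted. Each
  remaining half-line avoids \<open>F\<close> and stays in the component of its own end, and
  \<open>F0\<close> tells these components apart. So the neighbourhood contains points of far tails
  converging to \<open>\<epsilon> i\<close> only.\<close>

lemma end_separating_open:
  fixes N0 :: int
  obtains U where "U \<in> basic_opens V E" "End (\<epsilon> i) \<in> U" "\<And>j. End (\<epsilon> j) \<in> U \<Longrightarrow> m dvd i - j"
    "\<And>j y. line j y \<in> U \<Longrightarrow> m dvd i - j \<and> y < - real_of_int N0 \<or> m dvd i - (j + 1) \<and>
        y > real_of_int N0"
proof -
  obtain M where M: "\<And>j n. p j n \<in> F0 \<Longrightarrow> \<bar>n\<bar> \<le> M"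
    using finite_set_meets_lines_boundedly[OF F0(1)] by blast
  \<comment> \<open>With \<open>N\<close> at least \<open>M\<close>, the set \<open>F0\<close> adds
    no position outside the deleted segments. These reach to \<open>N + 1\<close> because a point at
    \<open>y\<close> may owe its membership to the vertex at \<open>\<lfloor>y\<rfloor>\<close> or
    at \<open>\<lfloor>y\<rfloor> + 1\<close>, and still \<open>y\<close> must lie beyond
    \<open>N\<close>.\<close>
  define N where "N = max 0 (max M N0)"
  define F where "F = F0 \<union> case_prod p ` ({0..<m} \<times> {-N-1..N+1})"
  have F: "finite F" "F0 \<subseteq> F" "F \<subseteq> V" using F0 p_V by (auto simp: F_def)
  have pF: "p j n \<in> F \<longleftrightarrow> \<bar>n\<bar> \<le> N + 1" for j n
  proof
    assume n: "\<bar>n\<bar> \<le> N + 1"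
    have "p j n = p (j mod m) n" using p_cong[of j "j mod m"] by (simp add: minus_mod_eq_mult_div)
    moreover have "j mod m \<in> {0..<m}" using m_pos by simp
    ultimately show "p j n \<in> F" using n by (force simp: F_def)
  next
    assume "p j n \<in> F"
    then show "\<bar>n\<bar> \<le> N + 1"
      unfolding F_def using M[of j n] p_inj by (fastforce simp: N_def)
  qed
  let ?U = "end_nbhd V E F (\<epsilon> i)"
  define C where "C = end_component V E F (\<epsilon> i)"
  have comp: "end_component V E F (\<epsilon> j) \<in> components_minus V E F" for j
    by (rule end_component_in_components[OF simple eps_ends F(1,3)])
  then have C: "C \<in> components_minus V E F" by (simp add: C_def)
  have sep: "m dvd i - j" if "x \<in> C" "x \<in> end_component V E F (\<epsilon> j)" for x j
    using component_unique[OF C comp that] F0_separates[OF F] C_def by blast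
  have right: "m dvd i - (j + 1)" if "p j n \<in> C" "n > N + 1" for j n
  proof -
    obtain M where M: "\<And>n. n \<ge> M \<Longrightarrow> p j n \<in> end_component V E F (\<epsilon> (j + 1))"
      using right_tail[OF F(1,3)] by blast
    \<comment> \<open>Beyond \<open>N + 1\<close> the line never meets \<open>F\<close>, so it
      cannot leave \<open>C\<close> before reaching its tail, which identifies the end.\<close>
    have "p j k \<in> C" if "n \<le> k" for k using that
    proof (induction k rule: int_ge_induct)
      case (step k)
      then have "p j (k + 1) \<notin> F" using pF \<open>n > N + 1\<close> by auto
      then show ?case using component_edge[OF C simple step.IH p_edge] by blast
    qed (rule \<open>p j n \<in> C\<close>)
    then show ?thesis using sep[of "p j (max n M)"] M by auto
  qed
  have left: "m dvd i - j" if "p j n \<in> C" "n < - N - 1" for j n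
  proof -
    obtain M where M: "\<And>n. n \<le> M \<Longrightarrow> p j n \<in> end_component V E F (\<epsilon> j)"
      using left_tail[OF F(1,3)] by blast
    have "p j k \<in> C" if "k \<le> n" for k using that
    proof (induction k rule: int_le_induct)
      case (step k)
      then have "p j (k - 1) \<notin> F" using pF \<open>n < - N - 1\<close> by auto
      moreover have "{p j k, p j (k - 1)} \<in> E" using p_edge[of j "k - 1"]
          by (simp add: insert_commute)
      ultimately show ?case using component_edge[OF C simple step.IH] by blast
    qed (rule \<open>p j n \<in> C\<close>)
    then show ?thesis using sep[of "p j (min n M)"] M by auto
  qed
  have side: "n > N + 1 \<or> n < - N - 1" if "p j n \<in> C" for j n
    using that component_subset[OF C] pF[of j n] by auto
  show ?thesis
  proof
    show "?U \<in> basic_opens V E" using F eps_ends unfolding basic_opens_def by blast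
    show "End (\<epsilon> i) \<in> ?U" using eps_ends by (auto simp: end_nbhd_def Let_def)
    fix j assume "End (\<epsilon> j) \<in> ?U"
    then have "end_component V E F (\<epsilon> j) = C"
      unfolding end_nbhd_def Let_def C_def[symmetric]
      by (auto simp: inner_pts_def edge_pt_def vertex_pt_def)
    then show "m dvd i - j" using F0_separates[OF F, of i j] by (simp add: C_def)
  next
    fix j y assume "line j y \<in> ?U"
    then have "p j \<lfloor>y\<rfloor> \<in> C \<or> p j (\<lfloor>y\<rfloor> + 1) \<in> C"
      using line_in_end_nbhd_iff[OF F(1,3) eps_ends] by (auto simp: C_def)
    then obtain n where n: "p j n \<in> C" "n = \<lfloor>y\<rfloor> \<or> n = \<lfloor>y\<rfloor> + 1" by blast
    from side[OF n(1)] show "m dvd i - j \<and> y < - real_of_int N0 \<or> m dvd i - (j + 1) \<and>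
        y > real_of_int N0"
    proof
      assume *: "n > N + 1"
      then have "y > N" using n(2) by linarith
      moreover have "N0 \<le> N" by (simp add: N_def)
      ultimately show ?thesis using right[OF n(1) *] by linarith
    next
      assume *: "n < - N - 1"
      then have "y < - N" using n(2) by linarith
      moreover have "N0 \<le> N" by (simp add: N_def)
      ultimately show ?thesis using left[OF n(1) *] by linarith
    qed
  qed
qed

end

section \<open>An interval wrapped once around the unit circle\<close>

lemma cis_quotient_map:
  fixes m :: real assumes "m > 0"
  shows "quotient_map (top_of_set {0..m}) (top_of_set (sphere (0::complex) 1)) (\<lambda>t. cis (2 * pi * t / m))"
proof (rule continuous_imp_quotient_map)
  show "continuous_map (top_of_set {0..m}) (top_of_set (sphere 0 1)) (\<lambda>t. cis (2 * pi * t / m))"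
    using assms by (auto intro!: continuous_intros)
  have "\<exists>t\<in>{0..m}. z = cis (2 * pi * t / m)" if "norm z = 1" for z :: complex
  proof -
    have "(Re z)\<^sup>2 + (Im z)\<^sup>2 = 1" using that by (metis cmod_power2 one_power2)
    then obtain a where a: "0 \<le> a" "a < 2 * pi" "Re z = cos a" "Im z = sin a"
      using sincos_total_2pi by metis
    have "z = cis (2 * pi * (m * a / (2 * pi)) / m)" using a assms by (simp add: complex_eq_iff)
    moreover have "m * a / (2 * pi) \<in> {0..m}" using a assms by (auto simp: field_simps)
    ultimately show ?thesis by blast
  qed
  then show "(\<lambda>t. cis (2 * pi * t / m)) ` topspace (top_of_set {0..m}) = topspace (top_of_set (sphere 0 1))"
    by (auto simp: image_iff)
qed (auto simp: compact_space_subtopology Hausdorff_space_subtopology)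

text \<open>By \<open>pt_eq_iff\<close>, the parametrization \<open>pt\<close> of the circle in
  \<open>|G|\<close> has the same fibres; therefore it factors through the unit circle.\<close>

lemma cis_eq_iff_period:
  fixes m s t :: real assumes "m > 0"
  shows "cis (2 * pi * s / m) = cis (2 * pi * t / m) \<longleftrightarrow> (\<exists>k::int. s = t + k * m)"
proof -
  have "cis (2 * pi * s / m) = cis (2 * pi * t / m) \<longleftrightarrow>
      (\<exists>k::int. 2 * pi * s / m = 2 * pi * t / m + 2 * pi * k)"
    using sin_cos_eq_iff[of "2 * pi * s / m" "2 * pi * t / m"]
    by (auto simp: complex_eq_iff algebra_simps)
  also have "\<dots> \<longleftrightarrow> (\<exists>k::int. s = t + k * m)"
  proof (rule ex_cong1)
    fix k :: int
    have "2 * pi * s / m = 2 * pi * t / m + 2 * pi * k \<longleftrightarrow> (2 * pi / m) * s = (2 * pi / m) * (t + k * m)"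
      using assms by (simp add: field_simps)
    then show "2 * pi * s / m = 2 * pi * t / m + 2 * pi * k \<longleftrightarrow> s = t + k * m" using assms by simp
  qed
  finally show ?thesis .
qed

section \<open>The parametrized circle\<close>

context double_ray_circle
begin

text \<open>Integers are sent to the ends, and the open interval between \<open>i\<close> and
  \<open>i + 1\<close> is stretched by the tangent onto the whole of line \<open>i\<close>.\<close>

definition pt :: "real \<Rightarrow> 'a gpoint" where
  "pt t = (if t = \<lfloor>t\<rfloor> then End (\<epsilon> \<lfloor>t\<rfloor>) else line \<lfloor>t\<rfloor> (tan (pi * (t - \<lfloor>t\<rfloor> - 1 / 2))))"

lemma pt_int: "pt (of_int i) = End (\<epsilon> i)"
  by (simp add: pt_def)

lemma pt_between:
  assumes "of_int i < t" "t < of_int i + 1"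
  shows "pt t = line i (tan (pi * (t - i - 1 / 2)))"
proof -
  have "\<lfloor>t\<rfloor> = i" using assms by linarith
  then show ?thesis using assms by (simp add: pt_def)
qed

lemma line_eq_pt: "line i x = pt (of_int i + 1 / 2 + arctan x / pi)"
proof -
  have "- (1 / 2) < arctan x / pi" "arctan x / pi < 1 / 2"
    using arctan_bounded[of x] by (simp_all add: field_simps)
  then have "of_int i < of_int i + 1 / 2 + arctan x / pi"
      "of_int i + 1 / 2 + arctan x / pi < of_int i + 1"
    by linarith+
  from pt_between[OF this] show ?thesis by (simp add: tan_arctan)
qed

lemma pt_cases:
  obtains i where "t = of_int i" "pt t = End (\<epsilon> i)"
  | i x where "of_int i < t" "t < of_int i + 1" "x = tan (pi * (t - i - 1 / 2))" "pt t = line i x"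
proof (cases "t = \<lfloor>t\<rfloor>")
  case True then show ?thesis using that(1)[OF True] pt_int[of "\<lfloor>t\<rfloor>"] by simp
next
  case False
  then have "of_int \<lfloor>t\<rfloor> < t" "t < of_int \<lfloor>t\<rfloor> + 1" by linarith+
  then show ?thesis using that(2) pt_between by blast
qed

lemma range_pt: "range pt = range (\<lambda>i. End (\<epsilon> i)) \<union> range (case_prod line)"
proof
  show "range pt \<subseteq> range (\<lambda>i. End (\<epsilon> i)) \<union> range (case_prod line)"
  proof (rule image_subsetI)
    fix t show "pt t \<in> range (\<lambda>i. End (\<epsilon> i)) \<union> range (case_prod line)"
      by (cases t rule: pt_cases) auto
  qed
  show "range (\<lambda>i. End (\<epsilon> i)) \<union> range (case_prod line) \<subseteq> range pt"
    by (auto simp: line_eq_pt simp flip: pt_int)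
qed

text \<open>At an integer \<open>i\<close> the tangent tends to minus infinity from the right and to
  plus infinity from the left, so \<open>end_nbhd_tails\<close> supplies both one-sided limits.
  Elsewhere continuity of the tangent and of the line suffices.\<close>

lemma pt_eventually_in:
  assumes "U \<in> basic_opens V E" "pt t \<in> U"
  shows "\<forall>\<^sub>F s in nhds t. pt s \<in> U"
proof (cases t rule: pt_cases)
  case (1 i)
  then have U: "End (\<epsilon> i) \<in> U" using assms by simp
  have "((\<lambda>s::real. pi * (s - i - 1 / 2)) \<longlongrightarrow> - (pi / 2)) (at_right (real_of_int i))"
    by (auto intro!: tendsto_eq_intros)
  moreover have ev: "\<forall>\<^sub>F s in at_right (real_of_int i). s \<in> {of_int i<..<of_int i + 1 :: real}"
    by (rule eventually_at_right_real) simp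
  then have "\<forall>\<^sub>F s::real in at_right (real_of_int i). pi * (s - i - 1 / 2) \<in> {- (pi / 2)<..} \<and>
      pi * (s - i - 1 / 2) \<noteq> - (pi / 2)"
    by eventually_elim (simp add: field_simps)
  ultimately have "LIM s at_right (real_of_int i). pi * (s - i - 1 / 2) :> at_right (- (pi / 2) :: real)"
    unfolding filterlim_at by (auto elim: eventually_mono)
  from filterlim_compose[OF filterlim_tan_at_right this]
  have "\<forall>\<^sub>F s in at_right (real_of_int i). line i (tan (pi * (s - i - 1 / 2))) \<in> U"
    using end_nbhd_tails(1)[OF assms(1) U] by (rule filterlim_iff[THEN iffD1, rule_format])
  with ev have R: "\<forall>\<^sub>F s in at_right (real_of_int i). pt s \<in> U"
    by eventually_elim (simp add: pt_between[of i])
  have "((\<lambda>s::real. pi * (s - of_int (i - 1) - 1 / 2)) \<longlongrightarrow> pi / 2) (at_left (real_of_int i))"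
    by (auto intro!: tendsto_eq_intros)
  moreover have ev: "\<forall>\<^sub>F s in at_left (real_of_int i). s \<in> {of_int i - 1<..<of_int i :: real}"
    by (rule eventually_at_left_real) simp
  then have "\<forall>\<^sub>F s::real in at_left (real_of_int i). pi * (s - of_int (i - 1) - 1 / 2) \<in> {..<pi / 2} \<and>
      pi * (s - of_int (i - 1) - 1 / 2) \<noteq> pi / 2"
    by eventually_elim (simp add: field_simps)
  ultimately have "LIM s at_left (real_of_int i). pi * (s - of_int (i - 1) - 1 / 2) :> at_left (pi / 2)"
    unfolding filterlim_at by (auto elim: eventually_mono)
  from filterlim_compose[OF filterlim_tan_at_left this]
  have "\<forall>\<^sub>F s in at_left (real_of_int i). line (i - 1) (tan (pi * (s - of_int (i - 1) - 1 / 2))) \<in> U"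
    using end_nbhd_tails(2)[OF assms(1) U] by (rule filterlim_iff[THEN iffD1, rule_format])
  with ev have "\<forall>\<^sub>F s in at_left (real_of_int i). pt s \<in> U"
    by eventually_elim (simp add: pt_between[of "i - 1"])
  with R show ?thesis using assms(2) 1 by (simp add: eventually_nhds_conv_at eventually_at_split)
next
  case (2 i x)
  have "\<bar>pi * (t - i - 1 / 2)\<bar> < pi / 2"
  proof -
    have "\<bar>t - i - 1 / 2\<bar> < 1 / 2" using 2(1,2) by linarith
    then have "pi * \<bar>t - i - 1 / 2\<bar> < pi * (1 / 2)" by (rule mult_strict_left_mono) simp
    then show ?thesis by (simp add: abs_mult)
  qed
  then have "cos (pi * (t - i - 1 / 2)) \<noteq> 0"
    using cos_gt_zero_pi[of "pi * (t - i - 1 / 2)"] by linarith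
  then have "isCont (\<lambda>s. tan (pi * (s - i - 1 / 2))) t"
    by (intro continuous_intros) auto
  then have "((\<lambda>s. tan (pi * (s - i - 1 / 2))) \<longlongrightarrow> x) (nhds t)"
    unfolding 2(3) isCont_def by (subst (asm) tendsto_at_iff_tendsto_nhds)
  then have "\<forall>\<^sub>F s in nhds t. line i (tan (pi * (s - i - 1 / 2))) \<in> U"
    using line_nbhd_in_basic[OF assms(1), of i x] assms(2) 2(4)
    by (auto simp: filterlim_iff)
  moreover have "\<forall>\<^sub>F s in nhds t. s \<in> {of_int i<..<of_int i + 1}"
    by (rule eventually_nhds_in_open) (use 2 in auto)
  ultimately show ?thesis by eventually_elim (simp add: pt_between[of i])
qed

lemma pt_in_topspace: "pt t \<in> \<Union> (basic_opens V E)"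
proof (cases t rule: pt_cases)
  case (1 i)
  have "\<exists>U. U \<in> basic_opens V E \<and> End (\<epsilon> i) \<in> U"
      by (rule end_separating_open[of i 0]) (intro exI conjI)
  then show ?thesis using 1 by auto
next
  case (2 i x)
  have "\<exists>U. U \<in> basic_opens V E \<and> line i x \<in> U"
    by (rule line_separating_open[of 1 i x], simp) (intro exI conjI)
  then show ?thesis using 2 by auto
qed

lemma topspace_end_space: "topspace (end_space V E) = \<Union> (basic_opens V E)"
  unfolding end_space_def by simp

lemma continuous_pt: "continuous_map euclideanreal (end_space V E) pt"
  unfolding end_space_def
proof (rule continuous_on_generated_topo)
  fix U assume "U \<in> basic_opens V E"
  have "\<exists>T. open T \<and> t \<in> T \<and> T \<subseteq> pt -` U" if "t \<in> pt -` U" for t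
    using pt_eventually_in[OF \<open>U \<in> basic_opens V E\<close>, of t] that by (auto simp: eventually_nhds)
  then have "open (pt -` U)" by (subst open_subopen) blast
  then show "openin euclideanreal (pt -` U \<inter> topspace euclideanreal)" by simp
qed (use pt_in_topspace in auto)

lemma pt_line_param:
  assumes "of_int i < t" "t < of_int i + 1"
  shows "t = of_int i + 1 / 2 + arctan (tan (pi * (t - i - 1 / 2))) / pi"
proof -
  have "- (pi / 2) < pi * (t - i - 1 / 2)" "pi * (t - i - 1 / 2) < pi / 2"
    using mult_strict_left_mono[of "-1/2" "t - i - 1/2" pi]
      mult_strict_left_mono[of "t - i - 1/2" "1/2" pi] assms by auto
  then show ?thesis by (simp add: arctan_tan)
qed

text \<open>The neighbourhoods are disjoint only within the range of \<open>pt\<close>: in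
  \<open>|G|\<close> itself, a vertex with infinitely many neighbours on a ray has no neighbourhood
  disjoint from one of the end of that ray.\<close>

lemma pt_separation:
  assumes "\<not> (\<exists>k::int. s = t + of_int (k * m))"
  shows "\<exists>U U'. U \<in> basic_opens V E \<and> U' \<in> basic_opens V E \<and> pt s \<in> U \<and> pt t \<in> U' \<and>
    U \<inter> U' \<inter> range pt = {}"
proof -
  have disj: "U \<inter> U' \<inter> range pt = {}"
    if "\<And>j. End (\<epsilon> j) \<in> U \<Longrightarrow> End (\<epsilon> j) \<in> U' \<Longrightarrow> False"
      "\<And>j y. line j y \<in> U \<Longrightarrow> line j y \<in> U' \<Longrightarrow> False" for U U'
    unfolding range_pt using that by auto
  have mixed: "\<exists>U U'. U \<in> basic_opens V E \<and> U' \<in> basic_opens V E \<and> End (\<epsilon> i) \<in> U \<and> line j x \<in> U' \<and>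
    U \<inter> U' \<inter> range pt = {}" for i j x
  proof -
    \<comment> \<open>The bound exceeds \<open>\<bar>x\<bar>\<close> by at least 2, so the tails in
      \<open>U\<close> avoid the interval of radius 1 around \<open>x\<close> that is used for
      \<open>U'\<close>.\<close>
    obtain U where U: "U \<in> basic_opens V E" "End (\<epsilon> i) \<in> U" "\<And>j. End (\<epsilon> j) \<in> U \<Longrightarrow> m dvd i - j"
      "\<And>j y. line j y \<in> U \<Longrightarrow> m dvd i - j \<and> y < - real_of_int (\<lceil>\<bar>x\<bar>\<rceil> + 2) \<or> m dvd i - (j + 1) \<and>
          y > real_of_int (\<lceil>\<bar>x\<bar>\<rceil> + 2)"
      by (rule end_separating_open[of i "\<lceil>\<bar>x\<bar>\<rceil> + 2"]) (rule that)
    obtain U' where U': "U' \<in> basic_opens V E" "line j x \<in> U'" "\<And>\<eta>. End \<eta> \<notin> U'"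
      "\<And>l y. line l y \<in> U' \<Longrightarrow> m dvd j - l \<and> \<bar>x - y\<bar> < 1"
      by (rule line_separating_open[of 1 j x], simp) (rule that)
    have "U \<inter> U' \<inter> range pt = {}"
    proof (rule disj)
      fix l y assume "line l y \<in> U" "line l y \<in> U'"
      then have "\<bar>x - y\<bar> < 1" "y < - real_of_int (\<lceil>\<bar>x\<bar>\<rceil> + 2) \<or> y > real_of_int (\<lceil>\<bar>x\<bar>\<rceil> + 2)"
          using U(4) U'(4) by blast+
      then show False by linarith
    qed (use U' in blast)
    then show ?thesis using U U' by blast
  qed
  show ?thesis
  proof (cases s rule: pt_cases)
    case s: (1 i)
    show ?thesis
    proof (cases t rule: pt_cases)
      case t: (1 j)
      have nd: "\<not> m dvd i - j"
      proof
        assume "m dvd i - j"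
        then obtain k where "i = j + k * m" by (auto simp: dvd_def algebra_simps)
        then show False using assms s t by auto
      qed
      \<comment> \<open>The bound 0 is enough: the sign of \<open>y\<close> tells which tail of the
        line a common point lies on, and that tail has only one end modulo \<open>m\<close>.\<close>
      obtain U where U: "U \<in> basic_opens V E" "End (\<epsilon> i) \<in> U" "\<And>j. End (\<epsilon> j) \<in> U \<Longrightarrow> m dvd i - j"
        "\<And>j y. line j y \<in> U \<Longrightarrow> m dvd i - j \<and> y < - real_of_int 0 \<or> m dvd i - (j + 1) \<and>
            y > real_of_int 0"
        by (rule end_separating_open[of i 0]) (rule that)
      obtain U' where U': "U' \<in> basic_opens V E" "End (\<epsilon> j) \<in> U'" "\<And>l. End (\<epsilon> l) \<in> U' \<Longrightarrow> m dvd j - l"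
        "\<And>l y. line l y \<in> U' \<Longrightarrow> m dvd j - l \<and> y < - real_of_int 0 \<or> m dvd j - (l + 1) \<and>
            y > real_of_int 0"
        by (rule end_separating_open[of j 0]) (rule that)
      have nd': "\<not> (m dvd i - l \<and> m dvd j - l)" for l
      proof
        assume "m dvd i - l \<and> m dvd j - l"
        then have "m dvd (i - l) - (j - l)" using dvd_diff by blast
        then show False using nd by simp
      qed
      have "U \<inter> U' \<inter> range pt = {}"
      proof (rule disj)
        fix l y assume "line l y \<in> U" "line l y \<in> U'"
        from U(4)[OF this(1)] U'(4)[OF this(2)] have "m dvd i - l \<and>
            m dvd j - l \<or> m dvd i - (l + 1) \<and> m dvd j - (l + 1)"
          by auto
        then show False using nd' by blast
      qed (use U(3) U'(3) nd' in blast)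
      then show ?thesis using U U' s t by auto
    next
      case t: (2 j y)
      show ?thesis using mixed[of i j y] unfolding s(2) t(4) .
    qed
  next
    case s: (2 i x)
    show ?thesis
    proof (cases t rule: pt_cases)
      case t: (1 j)
      show ?thesis using mixed[of j i x] unfolding s(4) t(2) by (metis Int_commute)
    next
      case t: (2 j y)
      \<comment> \<open>Half the distance separates two points of one line. For \<open>x = y\<close>
        the lines differ modulo \<open>m\<close>, and any positive radius will do.\<close>
      define \<delta> where "\<delta> = (if x = y then 1 else \<bar>x - y\<bar> / 2)"
      have ne: "x \<noteq> y" if "m dvd i - j"
      proof
        assume "x = y"
        then have "s - i = t - j"
            using pt_line_param[OF s(1,2)] pt_line_param[OF t(1,2)] s(3) t(3) by simp
        moreover obtain k where "i = j + k * m" using \<open>m dvd i - j\<close>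
            by (auto simp: dvd_def algebra_simps)
        ultimately have "s = t + of_int (k * m)" by simp
        then show False using assms by blast
      qed
      have "\<delta> > 0" by (simp add: \<delta>_def)
      obtain U where U: "U \<in> basic_opens V E" "line i x \<in> U" "\<And>\<eta>. End \<eta> \<notin> U"
        "\<And>l z. line l z \<in> U \<Longrightarrow> m dvd i - l \<and> \<bar>x - z\<bar> < \<delta>"
        by (rule line_separating_open[OF \<open>\<delta> > 0\<close>, of i x]) (rule that)
      obtain U' where U': "U' \<in> basic_opens V E" "line j y \<in> U'" "\<And>\<eta>. End \<eta> \<notin> U'"
        "\<And>l z. line l z \<in> U' \<Longrightarrow> m dvd j - l \<and> \<bar>y - z\<bar> < \<delta>"
        by (rule line_separating_open[OF \<open>\<delta> > 0\<close>, of j y]) (rule that)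
      have "U \<inter> U' \<inter> range pt = {}"
      proof (rule disj)
        fix l z assume "line l z \<in> U" "line l z \<in> U'"
        then have *: "m dvd i - l" "m dvd j - l" "\<bar>x - z\<bar> < \<delta>" "\<bar>y - z\<bar> < \<delta>" using U(4) U'(4)
            by blast+
        have "m dvd (i - l) - (j - l)" using *(1,2) by (rule dvd_diff)
        then have "\<delta> = \<bar>x - y\<bar> / 2" using ne by (simp add: \<delta>_def)
        moreover have "\<bar>x - y\<bar> \<le> \<bar>x - z\<bar> + \<bar>y - z\<bar>" by linarith
        ultimately show False using *(3,4) by simp
      qed (use U in blast)
      then show ?thesis using U U' s t by auto
    qed
  qed
qed

text \<open>Injectivity up to the period comes for free from separation: one point cannot lie in two
  neighbourhoods that are disjoint on the range.\<close>

lemma pt_eq_iff: "pt s = pt t \<longleftrightarrow> (\<exists>k::int. s = t + of_int (k * m))"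
proof
  assume eq: "pt s = pt t"
  show "\<exists>k::int. s = t + of_int (k * m)"
  proof (rule ccontr)
    assume "\<not> ?thesis"
    from pt_separation[OF this]
    obtain U U' where U: "pt s \<in> U" "pt t \<in> U'" and disj: "U \<inter> U' \<inter> range pt = {}"
      by (elim exE conjE)
    have "pt s \<in> U \<inter> U' \<inter> range pt" using U eq by simp
    then show False unfolding disj by simp
  qed
next
  assume "\<exists>k::int. s = t + of_int (k * m)"
  then obtain k :: int where k: "s = t + of_int (k * m)" by blast
  show "pt s = pt t"
  proof (cases t rule: pt_cases)
    case (1 i)
    then have "s = of_int (i + k * m)" using k by simp
    then show ?thesis using 1(2) pt_int[of "i + k * m"] eps_mult[of i k] by simp
  next
    case (2 i x)
    have "pt s = line (i + k * m) (tan (pi * (s - of_int (i + k * m) - 1 / 2)))"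
      by (rule pt_between) (use 2 k in auto)
    also have "s - of_int (i + k * m) = t - i" using k by simp
    finally show ?thesis using 2(3,4) p_mult[of i k] by (simp add: line_def)
  qed
qed

lemma Hausdorff_range_pt: "Hausdorff_space (subtopology (end_space V E) (range pt))"
  unfolding Hausdorff_space_def
proof (intro allI impI)
  fix x y assume "x \<in> topspace (subtopology (end_space V E) (range pt)) \<and>
      y \<in> topspace (subtopology (end_space V E) (range pt)) \<and> x \<noteq> y"
  then obtain s t where st: "x = pt s" "y = pt t" "x \<noteq> y" by auto
  then obtain U U' where U: "U \<in> basic_opens V E" "U' \<in> basic_opens V E" "pt s \<in> U" "pt t \<in> U'"
      "U \<inter> U' \<inter> range pt = {}"
    using pt_separation[of s t] unfolding pt_eq_iff[symmetric] by metis
  have "openin (subtopology (end_space V E) (range pt)) (W \<inter> range pt)"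
      if "W \<in> basic_opens V E" for W
    using that unfolding end_space_def by (intro openin_subtopology_Int topology_generated_by_Basis)
  then show "\<exists>W W'. openin (subtopology (end_space V E) (range pt)) W \<and>
      openin (subtopology (end_space V E) (range pt)) W' \<and> x \<in> W \<and> y \<in> W' \<and> disjnt W W'"
    using U st by (intro exI[of _ "U \<inter> range pt"] exI[of _ "U' \<inter> range pt"]) (auto simp: disjnt_def)
qed

text \<open>Restricted to one period, \<open>pt\<close> factors through the quotient map onto the
  unit circle. The induced map is a continuous bijection from a compact space onto a Hausdorff
  space, hence a homeomorphism.\<close>

lemma is_circle_range_pt: "is_circle V E (range pt)"
proof -
  let ?X = "top_of_set {0..real_of_int m}" and ?Y = "top_of_set (sphere (0::complex) 1)"
    and ?Z = "subtopology (end_space V E) (range pt)" and ?e = "\<lambda>t. cis (2 * pi * t / of_int m)"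
  have m: "real_of_int m > 0" using m_pos by simp
  have sub: "range pt \<subseteq> topspace (end_space V E)"
    using pt_in_topspace topspace_end_space by auto
  then have tZ: "topspace ?Z = range pt" by auto
  have q: "quotient_map ?X ?Y ?e" by (rule cis_quotient_map[OF m])
  have c: "continuous_map ?X ?Z pt"
    using continuous_map_from_subtopology[OF continuous_pt]
        by (auto simp: continuous_map_in_subtopology)
  have surj: "pt ` {0..of_int m} = range pt"
  proof
    show "range pt \<subseteq> pt ` {0..of_int m}"
    proof (rule image_subsetI)
      fix t
      define k where "k = \<lfloor>t / m\<rfloor>"
      have "k \<le> t / m" "t / m < k + 1" unfolding k_def by linarith+
      then have "t - k * m \<in> {0..of_int m}" using m by (auto simp: field_simps)
      moreover have "pt t = pt (t - k * m)" by (subst pt_eq_iff) (auto intro: exI[of _ k])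
      ultimately show "pt t \<in> pt ` {0..of_int m}" by blast
    qed
  qed auto
  have "pt s = pt t \<longleftrightarrow> ?e s = ?e t" for s t
    using pt_eq_iff cis_eq_iff_period[OF m] by auto
  note fib = this
  obtain g where g: "continuous_map ?Y ?Z g" "g ` topspace ?Y = pt ` topspace ?X"
      "\<And>x. x \<in> topspace ?X \<Longrightarrow> g (?e x) = pt x"
    by (rule quotient_map_lift_exists[OF q c]) (use fib that in auto)
  have "?e ` topspace ?X = topspace ?Y" using q by (auto simp: quotient_map_def)
  moreover have "inj_on g (?e ` topspace ?X)"
    by (rule inj_onI) (use g(3) fib in auto)
  ultimately have "inj_on g (topspace ?Y)" by metis
  then have "homeomorphic_map ?Y ?Z g"
    using g Hausdorff_range_pt surj tZ
    by (intro continuous_imp_homeomorphic_map) (auto simp: compact_space_subtopology)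
  then show ?thesis
    unfolding is_circle_def
        using sub homeomorphic_map_imp_homeomorphic_space homeomorphic_space_sym by blast
qed

lemma exists_cycle_through_double_rays:
  "\<exists>Z. is_cycle V E Z \<and> range (case_prod p) \<subseteq> fst Z"
proof (intro exI conjI)
  let ?T = "circle_edges E (range pt)"
  show "is_cycle V E (\<Union> ?T, ?T)" using is_circle_range_pt by (auto simp: is_cycle_def)
  have "{p i n, p i (n + 1)} \<in> ?T" for i n
  proof -
    \<comment> \<open>The midpoint of each edge of a double ray lies on the circle, which puts the
      edge into the cycle.\<close>
    have "\<lfloor>of_int n + 1 / 2 :: real\<rfloor> = n" by linarith
    then have "line i (of_int n + 1 / 2) \<in> inner_pts {p i n, p i (n + 1)}"
      using line_in_inner_iff[OF p_edge, of i "of_int n + 1 / 2" i n] by simp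
    moreover have "line i (of_int n + 1 / 2) \<in> range pt" by (simp add: line_eq_pt)
    ultimately show ?thesis using p_edge unfolding circle_edges_def by blast
  qed
  then show "range (case_prod p) \<subseteq> fst (\<Union> ?T, ?T)" by auto
qed

end

section \<open>Covering an infinitely connected set by two rays\<close>

abbreviation path_in :: "'a set set \<Rightarrow> 'a list \<Rightarrow> bool" where
  "path_in E \<equiv> successively (\<lambda>u v. {u, v} \<in> E)"

lemma connected_in_imp_path:
  assumes "(x, y) \<in> connected_in E W"
  obtains xs where "path_in E (x # xs)" "distinct (x # xs)" "last (x # xs) = y" "set (x # xs) \<subseteq> W"
proof -
  have x: "x \<in> W" using assms by (simp add: connected_in_def)
  have "(x, y) \<in> {(x, y). x \<in> W \<and> y \<in> W \<and> {x, y} \<in> E}\<^sup>*"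
    using assms by (simp add: connected_in_def)
  then have "\<exists>xs. path_in E (x # xs) \<and> distinct (x # xs) \<and> last (x # xs) = y \<and> set (x # xs) \<subseteq> W"
  proof (induction rule: rtrancl_induct)
    case base
    show ?case by (rule exI[of _ "[]"]) (use x in simp)
  next
    case (step y z)
    then obtain xs where xs: "path_in E (x # xs)" "distinct (x # xs)" "last (x # xs) = y"
        "set (x # xs) \<subseteq> W"
      by blast
    show ?case
    proof (cases "z \<in> set (x # xs)")
      case True
      \<comment> \<open>If the walk returns to a vertex already on the path, the path is cut back to
        that vertex.\<close>
      then obtain us vs where "x # xs = us @ z # vs" by (meson split_list)
      then have uv: "x # xs = (us @ [z]) @ vs" by simp
      then obtain ys where ys: "us @ [z] = x # ys" by (cases us) auto
      have eq: "x # xs = (x # ys) @ vs" using uv ys by simp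
      have "path_in E ((x # ys) @ vs)" "distinct ((x # ys) @ vs)" "set ((x # ys) @ vs) \<subseteq> W"
        using xs unfolding eq by blast+
      then have "path_in E (x # ys)" "distinct (x # ys)" "set (x # ys) \<subseteq> W"
        unfolding successively_append_iff by auto
      moreover have "last (x # ys) = z" using ys by (metis last_snoc)
      ultimately show ?thesis by blast
    next
      case False
      have "path_in E ((x # xs) @ [z])"
        unfolding successively_append_iff using xs step(2) by auto
      then show ?thesis using False xs step(2) by (intro exI[of _ "xs @ [z]"]) auto
    qed
  qed
  then show ?thesis using that by blast
qed

text \<open>Only vertices of \<open>D\<close> must remain connected; the larger set \<open>W\<close>
  supplies connecting vertices. Those may become isolated, as a vertex of degree two does when its
  neighbours are deleted.\<close>

definition inf_connected :: "'a set set \<Rightarrow> 'a set \<Rightarrow> 'a set \<Rightarrow> bool" where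
  "inf_connected E W D \<longleftrightarrow>
     (\<forall>T. finite T \<longrightarrow> (\<forall>x\<in>D - T. \<forall>y\<in>D - T. (x, y) \<in> connected_in E (W - T)))"

text \<open>The limit is \<open>L (Suc i) ! i\<close>: each step adds at least one entry, so
  \<open>L (Suc i)\<close> reaches position \<open>i\<close>, and later lists do not change
  it.\<close>

lemma increasing_lists_limit:
  fixes L :: "nat \<Rightarrow> 'a list"
  assumes "\<And>n. \<exists>p. p \<noteq> [] \<and> L (Suc n) = L n @ p"
  obtains R where "\<And>n i. i < length (L n) \<Longrightarrow> R i = L n ! i" "\<And>n. n \<le> length (L n)"
proof
  have len: "n \<le> length (L n)" for n
  proof (induction n)
    case (Suc n)
    obtain p where "p \<noteq> []" "L (Suc n) = L n @ p" using assms by blast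
    then have "length (L (Suc n)) \<ge> Suc (length (L n))" by (cases p) auto
    then show ?case using Suc by linarith
  qed simp
  then show "n \<le> length (L n)" for n .
  have pre: "\<exists>p. L n = L k @ p" if "k \<le> n" for k n
    using that
  proof (induction rule: dec_induct)
    case (step n)
    then show ?case using assms[of n] by auto
  qed simp
  fix n i assume i: "i < length (L n)"
  obtain a b where "L (max n (Suc i)) = L n @ a" "L (max n (Suc i)) = L (Suc i) @ b"
    using pre[of n "max n (Suc i)"] pre[of "Suc i" "max n (Suc i)"] by auto
  then have "L (Suc i) @ b = L n @ a" by simp
  moreover have "i < length (L (Suc i))" using len[of "Suc i"] by simp
  ultimately show "L (Suc i) ! i = L n ! i" using i by (metis nth_append)
qed

text \<open>Since deleting finitely many vertices never disconnects \<open>D\<close>, two disjoint finite paths can be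
  extended in turn so as to swallow any prescribed vertex of \<open>D\<close>.\<close>

lemma two_disjoint_rays_covering:
  assumes conn: "inf_connected E W D" and DW: "D \<subseteq> W" and inf: "infinite D" and cnt: "countable D"
    and T: "finite T" and x: "x \<in> D - T" and x': "x' \<in> D - T" and ne: "x \<noteq> x'"
  obtains R R' where "R \<in> rays E" "R' \<in> rays E" "R 0 = x" "R' 0 = x'" "range R \<inter> range R' = {}"
    "range R \<union> range R' \<subseteq> W - T" "D - T \<subseteq> range R \<union> range R'"
proof -
  \<comment> \<open>Both paths end in \<open>D\<close>, where infinite connectedness allows them to
    continue.\<close>
  define good
      where "good = (\<lambda>P Q. path_in E P \<and> path_in E Q \<and> distinct (P @ Q) \<and> set (P @ Q) \<subseteq> W - T \<and>
    P \<noteq> [] \<and> Q \<noteq> [] \<and> last P \<in> D \<and> last Q \<in> D)"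
  have good_swap: "good P Q \<Longrightarrow> good Q P" for P Q by (auto simp: good_def)
  have extend: "\<exists>p. p \<noteq> [] \<and> good (P @ p) Q \<and> y \<in> set p"
    if g: "good P Q" and y: "y \<in> D - T - set P - set Q" for P Q y
  proof -
    \<comment> \<open>Everything used so far is forbidden except the last vertex of
      \<open>P\<close>, from which the new piece starts.\<close>
    define T' where "T' = T \<union> set (butlast P) \<union> set Q"
    have P: "P = butlast P @ [last P]" using g by (simp add: good_def)
    have d: "distinct P" "set P \<inter> set Q = {}" "P \<noteq> []" using g by (auto simp: good_def)
    then have "last P \<notin> set (butlast P)" by (metis P distinct_butlast not_distinct_conv_prefix)
    moreover have lP: "last P \<in> set P" "last P \<in> D" "set P \<inter> T = {}" using g d(3)
        by (auto simp: good_def)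
    ultimately have "last P \<in> D - T'" using d(2) unfolding T'_def by blast
    moreover have "y \<in> D - T'" using y by (auto simp: T'_def dest: in_set_butlastD)
    moreover have "finite T'" using T by (simp add: T'_def)
    ultimately have "(last P, y) \<in> connected_in E (W - T')" using conn
        by (auto simp: inf_connected_def)
    then obtain xs where xs: "path_in E (last P # xs)" "distinct (last P # xs)"
        "last (last P # xs) = y" "set (last P # xs) \<subseteq> W - T'"
      by (rule connected_in_imp_path)
    have "y \<noteq> last P" using y lP(1) by blast
    then have xs0: "xs \<noteq> []" "last xs = y" using xs(3) by (auto split: if_splits)
    have "path_in E (P @ xs)"
      unfolding successively_append_iff
      using xs(1) xs0 g by (auto simp: good_def successively_Cons)
    moreover have "set xs \<inter> set P = {}"
    proof -
      have "set P = insert (last P) (set (butlast P))" by (subst P) auto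
      then show ?thesis using xs(2,4) by (auto simp: T'_def)
    qed
    moreover have "set xs \<inter> set Q = {}" "set xs \<inter> T = {}" "set xs \<subseteq> W" using xs(4)
        by (auto simp: T'_def)
    ultimately have "good (P @ xs) Q" using g xs(2) xs0 y by (auto simp: good_def)
    moreover have "y \<in> set xs" using xs0 last_in_set by blast
    ultimately show ?thesis using xs0 by blast
  qed
  have fresh: "\<exists>y. y \<in> D - T - set P - set Q" for P Q
  proof -
    have "infinite (D - T - set P - set Q)" using inf T by (simp add: Diff_infinite_finite)
    then show ?thesis by (metis ex_in_conv finite.emptyI)
  qed
  have step: "\<exists>p q. p \<noteq> [] \<and> q \<noteq> [] \<and> good (P @ p) (Q @ q) \<and> y \<in> set (P @ p) \<union> set (Q @ q)"
    if g: "good P Q" and y: "y \<in> D - T" for P Q y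
  proof -
    \<comment> \<open>The target is \<open>y\<close> unless it is already covered; a fresh vertex
      then takes its place, so that the path grows properly in every round.\<close>
    obtain z where z: "z \<in> D - T - set P - set Q" "y \<in> set P \<union> set Q \<or> z = y"
      using fresh[of P Q] y by blast
    obtain p where p: "p \<noteq> []" "good (P @ p) Q" "z \<in> set p" using extend[OF g z(1)] by blast
    obtain w where w: "w \<in> D - T - set Q - set (P @ p)" using fresh by blast
    obtain q where q: "q \<noteq> []" "good (Q @ q) (P @ p)" using extend[OF good_swap[OF p(2)] w] by blast
    show ?thesis using p q z good_swap[OF q(2)] by auto
  qed
  define d where "d = from_nat_into (D - T)"
  have D_ne: "D - T \<noteq> {}" using x by blast
  then have d_in: "d n \<in> D - T" for n unfolding d_def by (rule from_nat_into)
  have d_surj: "\<exists>n. d n = y" if "y \<in> D - T" for y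
    unfolding d_def by (rule from_nat_into_surj[OF _ that]) (use cnt in auto)
  \<comment> \<open>Round \<open>n\<close> swallows the \<open>n\<close>-th vertex of
    \<open>D - T\<close> in a fixed enumeration.\<close>
  have "\<exists>S. \<forall>n. (good (fst (S n)) (snd (S n)) \<and> (n = 0 \<longrightarrow> S n = ([x], [x']))) \<and>
     ((\<exists>p. p \<noteq> [] \<and> fst (S (Suc n)) = fst (S n) @ p) \<and> (\<exists>q. q \<noteq> [] \<and> snd (S (Suc n)) = snd (S n) @ q) \<and>
       d n \<in> set (fst (S (Suc n))) \<union> set (snd (S (Suc n))))"
  proof (rule dependent_nat_choice)
    have "good [x] [x']" using x x' ne DW by (auto simp: good_def)
    then show "\<exists>s. good (fst s) (snd s) \<and> ((0::nat) = 0 \<longrightarrow> s = ([x], [x']))"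
      by (intro exI[of _ "([x], [x'])"]) simp
    fix s and n :: nat assume "good (fst s) (snd s) \<and> (n = 0 \<longrightarrow> s = ([x], [x']))"
    then obtain p q where pq: "p \<noteq> []" "q \<noteq> []" "good (fst s @ p) (snd s @ q)"
        "d n \<in> set (fst s @ p) \<union> set (snd s @ q)"
      using step d_in by blast
    then show "\<exists>s'. (good (fst s') (snd s') \<and> (Suc n = 0 \<longrightarrow> s' = ([x], [x']))) \<and>
        ((\<exists>p. p \<noteq> [] \<and> fst s' = fst s @ p) \<and> (\<exists>q. q \<noteq> [] \<and> snd s' = snd s @ q) \<and>
         d n \<in> set (fst s') \<union> set (snd s'))"
      by (intro exI[of _ "(fst s @ p, snd s @ q)"]) auto
  qed
  then obtain S where good_S: "\<And>n. good (fst (S n)) (snd (S n))" and S0: "S 0 = ([x], [x'])"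
    and S1: "\<And>n. \<exists>p. p \<noteq> [] \<and> fst (S (Suc n)) = fst (S n) @ p"
    and S2: "\<And>n. \<exists>p. p \<noteq> [] \<and> snd (S (Suc n)) = snd (S n) @ p"
    and dS: "\<And>n. d n \<in> set (fst (S (Suc n))) \<union> set (snd (S (Suc n)))"
    by blast
  obtain R where R: "\<And>n i. i < length (fst (S n)) \<Longrightarrow> R i = fst (S n) ! i"
      "\<And>n. n \<le> length (fst (S n))"
    using increasing_lists_limit[of "\<lambda>n. fst (S n)", OF S1] by blast
  obtain R' where R': "\<And>n i. i < length (snd (S n)) \<Longrightarrow> R' i = snd (S n) ! i"
      "\<And>n. n \<le> length (snd (S n))"
    using increasing_lists_limit[of "\<lambda>n. snd (S n)", OF S2] by blast
  have lim: "r \<in> rays E \<and> (\<forall>i. r i \<in> set (L (Suc i))) \<and> (\<forall>n. set (L n) \<subseteq> range r) \<and>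
      (\<forall>i n. i < n \<longrightarrow> r i \<in> set (L n))"
    if r: "\<And>n i. i < length (L n) \<Longrightarrow> r i = L n ! i" "\<And>n. n \<le> length (L n)"
      and L: "\<And>n. path_in E (L n)" "\<And>n. distinct (L n)" for L :: "nat \<Rightarrow> 'a list" and r
  proof -
    have "r i \<noteq> r j" if "i < j" for i j
    proof -
      have "j < length (L (Suc j))" using r(2)[of "Suc j"] by simp
      moreover from this that have "i < length (L (Suc j))" by simp
      ultimately show ?thesis using r(1) L(2)[of "Suc j"] that
          by (metis less_imp_neq nth_eq_iff_index_eq)
    qed
    then have "inj r" by (metis injI linorder_neqE_nat)
    moreover have "{r n, r (Suc n)} \<in> E" for n
    proof -
      have "Suc n < length (L (Suc (Suc n)))" using r(2)[of "Suc (Suc n)"] by simp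
      moreover from this have "{L (Suc (Suc n)) ! n, L (Suc (Suc n)) ! Suc n} \<in> E"
        using L(1)[of "Suc (Suc n)"] by (simp add: successively_conv_nth)
      ultimately show ?thesis using r(1) by (metis Suc_lessD)
    qed
    moreover have "r i \<in> set (L n)" if "i < n" for i n
      using r(1)[of i n] r(2)[of n] that by (metis nth_mem order_less_le_trans)
    moreover have "set (L n) \<subseteq> range r" for n
      using r(1) by (metis in_set_conv_nth rangeI subsetI)
    ultimately show ?thesis by (simp add: rays_def)
  qed
  have LR: "R \<in> rays E" "\<And>n. set (fst (S n)) \<subseteq> range R" "\<And>i n. i < n \<Longrightarrow> R i \<in> set (fst (S n))"
    using lim[of "\<lambda>n. fst (S n)" R, OF R] good_S by (auto simp: good_def)
  have LR': "R' \<in> rays E" "\<And>n. set (snd (S n)) \<subseteq> range R'" "\<And>i n. i < n \<Longrightarrow> R' i \<in> set (snd (S n))"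
    using lim[of "\<lambda>n. snd (S n)" R', OF R'] good_S by (auto simp: good_def)
  show ?thesis
  proof
    show "R \<in> rays E" "R' \<in> rays E" by (fact LR(1), fact LR'(1))
    show "R 0 = x" "R' 0 = x'" using R(1)[of 0 0] R'(1)[of 0 0] S0 by auto
    have "R i \<noteq> R' j" for i j
    proof -
      have "R i \<in> set (fst (S (Suc (max i j))))" "R' j \<in> set (snd (S (Suc (max i j))))"
        by (rule LR(3) LR'(3); simp)+
      then show ?thesis using good_S[of "Suc (max i j)"] by (auto simp: good_def)
    qed
    then show "range R \<inter> range R' = {}" by auto
    show "range R \<union> range R' \<subseteq> W - T"
      using LR(3)[OF lessI] LR'(3)[OF lessI] good_S by (fastforce simp: good_def)
    show "D - T \<subseteq> range R \<union> range R'"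
    proof
      fix y assume "y \<in> D - T"
      then obtain n where "d n = y" using d_surj by blast
      then show "y \<in> range R \<union> range R'" using dS[of n] LR(2) LR'(2) by blast
    qed
  qed
qed

section \<open>Infinitely connected parts\<close>

lemma nbrs_edge: "{u, v} \<in> E \<longleftrightarrow> u \<in> nbrs E v"
  by (simp add: nbrs_def)

lemma bipartite_edge_cases:
  assumes "bipartite_graph A B E" "{u, v} \<in> E"
  shows "u \<in> A \<and> v \<in> B \<or> u \<in> B \<and> v \<in> A"
  using assms unfolding bipartite_graph_def by (fastforce simp: doubleton_eq_iff)

lemma bipartite_nbrs_subset:
  assumes "bipartite_graph A B E"
  shows "b \<in> B \<Longrightarrow> nbrs E b \<subseteq> A" and "a \<in> A \<Longrightarrow> nbrs E a \<subseteq> B"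
  using bipartite_edge_cases[OF assms] assms unfolding nbrs_def bipartite_graph_def by blast+

lemma bipartite_simple_graph:
  assumes "bipartite_graph A B E" shows "simple_graph (A \<union> B) E"
  using bipartite_edge_cases[OF assms] assms unfolding simple_graph_def bipartite_graph_def by blast

text \<open>The rays for a part \<open>D\<close> are to stay in this set. Two disjoint parts of
  \<open>A\<close> have disjoint hulls when no vertex of \<open>B\<close> is isolated, so rays of
  different parts cannot meet.\<close>

definition hull_in :: "'a set \<Rightarrow> 'a set set \<Rightarrow> 'a set \<Rightarrow> 'a set" where
  "hull_in B E D = D \<union> {b \<in> B. nbrs E b \<subseteq> D}"

text \<open>Degree-two vertices of \<open>B\<close> act as edges on \<open>A\<close>; if \<open>D\<close> stays connected along them whenever
  finitely many vertices of \<open>A\<close> are deleted, then it does so when finitely many of these edges are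
  deleted as well: the detour through a third vertex \<open>z\<close> avoids the edge between \<open>x\<close> and \<open>y\<close>.\<close>

lemma inf_connectedI:
  assumes bip: "bipartite_graph A B E" and D: "D \<subseteq> A" "infinite D" and B2: "B2 \<subseteq> B"
      "\<And>b. b \<in> B2 \<Longrightarrow> finite (nbrs E b)"
    and conn: "\<And>T x y. finite T \<Longrightarrow> x \<in> D - T \<Longrightarrow> y \<in> D - T \<Longrightarrow>
      (x, y) \<in> {(u, v). u \<in> D - T \<and> v \<in> D - T \<and> (\<exists>b\<in>B2. u \<noteq> v \<and> nbrs E b = {u, v})}\<^sup>*"
  shows "inf_connected E (hull_in B E D) D"
  unfolding inf_connected_def
proof (intro allI impI ballI)
  let ?W = "hull_in B E D"
  fix T x y assume T: "finite T" and x: "x \<in> D - T" and y: "y \<in> D - T"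
  \<comment> \<open>A deleted vertex of degree two is simulated by deleting its neighbours, except
    that \<open>x\<close> and \<open>y\<close> must survive.\<close>
  define T' where "T' = (T \<union> (\<Union>b\<in>T \<inter> B2. nbrs E b)) - {x, y}"
  have T': "finite T'" "x \<notin> T'" "y \<notin> T'" using T B2 by (auto simp: T'_def)
  have route: "(u, z) \<in> connected_in E (?W - T)"
    if u: "u \<in> {x, y}" and z: "z \<in> D - T' - {x, y}" and w: "w \<in> {x, y}" "w \<noteq> u" for u z w
  proof -
    \<comment> \<open>The other endpoint \<open>w\<close> is deleted too. A degree-two vertex of
      \<open>T\<close> that was still in use would then have both neighbours among \<open>x\<close>
      and \<open>y\<close>, hence \<open>w\<close> as a neighbour.\<close>
    have "u \<in> D - insert w T'" "z \<in> D - insert w T'" using u z w x y T' by auto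
    with T'(1) have "(u, z) \<in> {(p, q). p \<in> D - insert w T' \<and> q \<in> D - insert w T' \<and> (\<exists>b\<in>B2. p \<noteq> q \<and>
        nbrs E b = {p, q})}\<^sup>*"
      by (intro conn) auto
    then show ?thesis
    proof (induction rule: rtrancl_induct)
      case base
      show ?case by (rule connected_in_refl) (use u x y in \<open>auto simp: hull_in_def\<close>)
    next
      case (step p q)
      then obtain b where b: "b \<in> B2" "p \<noteq> q" "nbrs E b = {p, q}" and pq: "p \<in> D - insert w T'"
          "q \<in> D - insert w T'" by auto
      have "b \<notin> T"
      proof
        assume "b \<in> T"
        then have "p \<in> {x, y}" "q \<in> {x, y}" using b pq by (auto simp: T'_def)
        then show False using b(2) pq u w by auto
      qed
      moreover have "b \<in> ?W" "p \<in> ?W" "q \<in> ?W" using b pq B2 by (auto simp: hull_in_def)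
      moreover have "p \<notin> T" "q \<notin> T" using pq x y by (auto simp: T'_def)
      moreover have "{p, b} \<in> E" "{b, q} \<in> E"
        using b(3) nbrs_edge[of p b E] nbrs_edge[of q b E] by (simp_all add: insert_commute[of b q])
      ultimately have "(p, b) \<in> connected_in E (?W - T)" "(b, q) \<in> connected_in E (?W - T)"
        by (auto intro: connected_in_edge)
      then show ?case using step.IH connected_in_trans by metis
    qed
  qed
  show "(x, y) \<in> connected_in E (?W - T)"
  proof (cases "x = y")
    case True then show ?thesis using x by (auto intro!: connected_in_refl simp: hull_in_def)
  next
    case False
    have "infinite (D - T' - {x, y})" using D T' by (simp add: Diff_infinite_finite)
    then obtain z where z: "z \<in> D - T' - {x, y}" by (metis ex_in_conv finite.emptyI)
    have "(x, z) \<in> connected_in E (?W - T)" "(y, z) \<in> connected_in E (?W - T)"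
      using route[OF _ z, of x y] route[OF _ z, of y x] False by auto
    then show ?thesis using connected_in_sym connected_in_trans by metis
  qed
qed

lemma infinitely_connected_parts:
  assumes dHp: "dHp_graph A B E" and A: "infinite A"
    and deg: "\<And>b. b \<in> B \<Longrightarrow> card (nbrs E b) = 2 \<or> nbrs E b = A"
  obtains F \<D> where "finite F" "F \<subseteq> A \<union> B" "finite \<D>" "\<D> \<noteq> {}" "disjoint \<D>" "A \<subseteq> F \<union> \<Union> \<D>"
    "\<And>D. D \<in> \<D> \<Longrightarrow> infinite D \<and> D \<subseteq> A - F \<and> inf_connected E (hull_in B E D) D"
    "\<And>b D. b \<in> B - F \<Longrightarrow> D \<in> \<D> \<Longrightarrow> nbrs E b \<inter> D \<noteq> {} \<Longrightarrow> nbrs E b \<subseteq> D \<union> F"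
proof -
  have bip: "bipartite_graph A B E" using dHp by (simp add: dHp_graph_def)
  define full where "full = {b \<in> B. nbrs E b = A}"
  have full_edge: "{a, b} \<in> E" "{b, a} \<in> E" if "b \<in> full" "a \<in> A" for a b
    using that nbrs_edge[of a b E] by (simp_all add: full_def insert_commute[of b a])
  show ?thesis
  proof (cases "finite full")
    case False
    have "inf_connected E (hull_in B E A) A"
      unfolding inf_connected_def
    proof (intro allI impI ballI)
      fix T x y assume T: "finite T" "x \<in> A - T" "y \<in> A - T"
      \<comment> \<open>Any two vertices of \<open>A\<close> have infinitely many common neighbours
        here, and one of them survives.\<close>
      obtain b where b: "b \<in> full - T" using False T(1)
          by (metis Diff_infinite_finite ex_in_conv finite.emptyI)
      then have "b \<in> hull_in B E A - T" by (auto simp: hull_in_def full_def)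
      then have "(x, b) \<in> connected_in E (hull_in B E A - T)"
          "(b, y) \<in> connected_in E (hull_in B E A - T)"
        using T full_edge b by (auto intro!: connected_in_edge simp: hull_in_def)
      then show "(x, y) \<in> connected_in E (hull_in B E A - T)" by (rule connected_in_trans)
    qed
    moreover have "\<And>b. b \<in> B \<Longrightarrow> nbrs E b \<subseteq> A" using bipartite_nbrs_subset[OF bip] by blast
    ultimately show ?thesis using A by (intro that[of "{}" "{A}"]) auto
  next
    case True
    define B2 where "B2 = B - full"
    have B2: "card (nbrs E b) = 2" if "b \<in> B2" for b using deg that by (auto simp: B2_def full_def)
    then have B2_fin: "finite (nbrs E b)" if "b \<in> B2" for b using that card.infinite by fastforce
    \<comment> \<open>A finite partition of \<open>A - F\<close> into nonempty sets, no two of them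
      met by the neighbourhood of the same degree-two vertex. Parts may be finite or
      disconnected.\<close>
    define parts
        where "parts = (\<lambda>F \<P>. finite F \<and> F \<subseteq> A \<and> finite \<P> \<and> \<Union> \<P> = A - F \<and> {} \<notin> \<P> \<and> disjoint \<P> \<and>
      (\<forall>b\<in>B2. \<forall>P\<in>\<P>. \<forall>Q\<in>\<P>. nbrs E b \<inter> P \<noteq> {} \<longrightarrow> nbrs E b \<inter> Q \<noteq> {} \<longrightarrow> P = Q))"
    \<comment> \<open>A transversal \<open>X\<close> has \<open>N2\<close> inside
      \<open>full\<close>, since a degree-two vertex meets only one part. The maximum with 1 covers
      transversals with fewer than two elements, of which the dHp condition says nothing.\<close>
    have bound: "card \<P> \<le> max 1 (card full)" if parts: "parts F \<P>" for F \<P>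
    proof (rule ccontr)
      assume "\<not> card \<P> \<le> max 1 (card full)"
      then have c: "2 \<le> card \<P>" "card full < card \<P>" by auto
      have "\<exists>x. x \<in> P" if "P \<in> \<P>" for P using that parts by (metis ex_in_conv parts_def)
      then obtain f where f: "\<And>P. P \<in> \<P> \<Longrightarrow> f P \<in> P" by metis
      have uniq: "P = Q" if "P \<in> \<P>" "Q \<in> \<P>" "z \<in> P" "z \<in> Q" for P Q z
        using that parts unfolding parts_def by (metis disjnt_iff pairwiseD)
      have "inj_on f \<P>" using f uniq by (metis inj_onI)
      define X where "X = f ` \<P>"
      have X: "finite X" "card X = card \<P>" using \<open>inj_on f \<P>\<close> parts
          by (auto simp: X_def parts_def card_image)
      have XA: "X \<subseteq> A" using f parts by (auto simp: X_def parts_def)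
      have two: "at_least_two X"
        using X c(1) card_le_Suc0_iff_eq[of X] unfolding at_least_two_def by auto
      have "N2 (A \<union> B) E X \<subseteq> full"
      proof
        fix v assume v: "v \<in> N2 (A \<union> B) E X"
        then obtain x y where xy: "x \<in> nbrs E v" "y \<in> nbrs E v" "x \<in> X" "y \<in> X" "x \<noteq> y"
          by (auto simp: N2_def at_least_two_def)
        have "v \<in> B" using v xy XA bipartite_nbrs_subset(2)[OF bip, of v] bip
          by (auto simp: N2_def bipartite_graph_def)
        show "v \<in> full"
        proof (rule ccontr)
          assume "v \<notin> full"
          then have "v \<in> B2" using \<open>v \<in> B\<close> by (simp add: B2_def)
          obtain P Q where PQ: "P \<in> \<P>" "Q \<in> \<P>" "x = f P" "y = f Q" using xy by (auto simp: X_def)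
          have "nbrs E v \<inter> P \<noteq> {}" "nbrs E v \<inter> Q \<noteq> {}"
              using f[OF PQ(1)] f[OF PQ(2)] PQ(3,4) xy(1,2) by auto
          then have "P = Q"
            using parts \<open>v \<in> B2\<close> PQ(1,2) unfolding parts_def by simp
          then show False using xy(5) PQ by simp
        qed
      qed
      moreover have "X \<lesssim> N2 (A \<union> B) E X" using dHp XA two by (simp add: dHp_graph_def)
      ultimately have "X \<lesssim> full" using lepoll_trans subset_imp_lepoll by blast
      then have "card X \<le> card full" using lepoll_iff_card_le[OF X(1) True] by simp
      then show False using c X by simp
    qed
    let ?Q = "\<lambda>n. \<exists>F \<P>. parts F \<P> \<and> card \<P> = n"
    have "parts {} {A}" using A by (auto simp: parts_def)
    then have ex: "?Q 1" by (intro exI[of _ "{}"] exI[of _ "{A}"]) simp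
    have bd: "\<And>n. ?Q n \<Longrightarrow> n \<le> max 1 (card full)" using bound by blast
    obtain F \<P> where parts: "parts F \<P>" and "card \<P> = (GREATEST n. ?Q n)"
      using GreatestI_nat[of ?Q 1 "max 1 (card full)"] ex bd by blast
    then have max: "card \<P>' \<le> card \<P>" if "parts F' \<P>'" for F' \<P>'
      using Greatest_le_nat[of ?Q "card \<P>'" "max 1 (card full)"] bd that by auto
    have F: "finite F" "F \<subseteq> A" "finite \<P>" "\<Union> \<P> = A - F" "{} \<notin> \<P>" "disjoint \<P>"
      and cross: "\<And>b P Q. b \<in> B2 \<Longrightarrow> P \<in> \<P> \<Longrightarrow> Q \<in> \<P> \<Longrightarrow> nbrs E b \<inter> P \<noteq> {} \<Longrightarrow> nbrs E b \<inter> Q \<noteq> {} \<Longrightarrow> P = Q"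
      using parts unfolding parts_def by blast+
    define \<D> where "\<D> = {P \<in> \<P>. infinite P}"
    \<comment> \<open>Finite parts are absorbed into the separating set, and so are the vertices
      adjacent to all of \<open>A\<close>, the only ones that can still join different
      parts.\<close>
    define F' where "F' = F \<union> full \<union> \<Union> {P \<in> \<P>. finite P}"
    have conn: "inf_connected E (hull_in B E D) D" if D: "D \<in> \<D>" for D
    proof (rule inf_connectedI[OF bip])
      show DA: "D \<subseteq> A" "infinite D" using D F(4) by (auto simp: \<D>_def)
      show "B2 \<subseteq> B" by (auto simp: B2_def)
      show "finite (nbrs E b)" if "b \<in> B2" for b by (rule B2_fin[OF that])
      fix T x y assume T: "finite T" "x \<in> D - T" "y \<in> D - T"
      let ?r = "{(u, v). u \<in> D - T \<and> v \<in> D - T \<and> (\<exists>b\<in>B2. u \<noteq> v \<and> nbrs E b = {u, v})}"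
      show "(x, y) \<in> ?r\<^sup>*"
      proof (rule ccontr)
        assume nxy: "(x, y) \<notin> ?r\<^sup>*"
        \<comment> \<open>If \<open>y\<close> is not reachable from \<open>x\<close>, the reachable
          set \<open>U\<close> and the rest \<open>U'\<close> of \<open>D - T\<close> replace
          \<open>D\<close>. This gives one part more, against the choice of
          \<open>\<P>\<close>.\<close>
        define U U' where "U = {z \<in> D - T. (x, z) \<in> ?r\<^sup>*}" and "U' = (D - T) - U"
        have UU: "x \<in> U" "y \<in> U'" "U \<inter> U' = {}" "U \<union> U' = D - T" using T nxy
            by (auto simp: U_def U'_def)
        define \<P>' where "\<P>' = insert U (insert U' (\<P> - {D}))"
        have DP: "D \<in> \<P>" using D by (simp add: \<D>_def)
        have dj: "P \<inter> D = {}" if "P \<in> \<P> - {D}" for P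
          using that DP F(6) by (auto simp: pairwise_def disjnt_def)
        have U_new: "U \<notin> \<P> - {D}" "U' \<notin> \<P> - {D}" "U \<noteq> U'" using UU dj T by blast+
        have nocross: "\<not> (nbrs E b \<inter> U \<noteq> {} \<and> nbrs E b \<inter> U' \<noteq> {})" if b: "b \<in> B2" for b
        proof
          assume "nbrs E b \<inter> U \<noteq> {} \<and> nbrs E b \<inter> U' \<noteq> {}"
          then obtain u v where uv: "u \<in> nbrs E b" "u \<in> U" "v \<in> nbrs E b" "v \<in> U'" by blast
          then have "u \<noteq> v" using UU by blast
          then have "nbrs E b = {u, v}" using uv B2[OF b] by (auto simp: card_2_iff)
          then have "(u, v) \<in> ?r" using uv b \<open>u \<noteq> v\<close> by (auto simp: U_def U'_def)
          then show False using uv by (auto simp: U_def U'_def intro: rtrancl_into_rtrancl)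
        qed
        have sub: "nbrs E b \<inter> D \<noteq> {}" if "nbrs E b \<inter> U \<noteq> {} \<or> nbrs E b \<inter> U' \<noteq> {}" for b
          using that UU by blast
        have "parts (F \<union> (T \<inter> D)) \<P>'"
          unfolding parts_def
        proof (intro conjI ballI impI)
          show "finite (F \<union> (T \<inter> D))" "F \<union> (T \<inter> D) \<subseteq> A" "finite \<P>'" "{} \<notin> \<P>'"
            using F T DA UU by (auto simp: \<P>'_def)
          have "\<Union> (\<P> - {D}) = \<Union> \<P> - D" using DP dj by auto
          then have "\<Union> \<P>' = (D - T) \<union> (A - F - D)" unfolding \<P>'_def using UU(4) F(4) by auto
          moreover have "D \<subseteq> A - F" using F(4) Union_upper[OF DP] by simp
          ultimately show "\<Union> \<P>' = A - (F \<union> (T \<inter> D))" by auto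
          have "disjoint (\<P> - {D})" using F(6) by (rule pairwise_subset) auto
          moreover have "disjnt U P" "disjnt U' P" if "P \<in> \<P> - {D}" for P
            using dj[OF that] UU by (auto simp: disjnt_def)
          ultimately show "disjoint \<P>'"
            using UU(3) unfolding \<P>'_def pairwise_insert by (auto simp: disjnt_def Int_commute)
          fix b P Q assume b: "b \<in> B2" "P \<in> \<P>'" "Q \<in> \<P>'" "nbrs E b \<inter> P \<noteq> {}" "nbrs E b \<inter> Q \<noteq> {}"
          have mixed: "R' \<noteq> U \<and> R' \<noteq> U'" if "R \<in> \<P> - {D}" "nbrs E b \<inter> R \<noteq> {}"
              "nbrs E b \<inter> R' \<noteq> {}" for R R'
            using cross[OF b(1) DP, of R] sub[of b] that by auto
          show "P = Q"
          proof (cases "P \<in> \<P> - {D} \<or> Q \<in> \<P> - {D}")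
            case True
            then have "P \<in> \<P> - {D}" "Q \<in> \<P> - {D}"
              using mixed[of P Q] mixed[of Q P] b by (auto simp: \<P>'_def)
            then show ?thesis using cross[OF b(1)] b(4,5) by simp
          next
            case False
            then have "P = U \<or> P = U'" "Q = U \<or> Q = U'" using b(2,3) by (auto simp: \<P>'_def)
            then show ?thesis using nocross[OF b(1)] b(4,5) by auto
          qed
        qed
        moreover have "card \<P>' = Suc (card \<P>)"
        proof -
          have "card \<P>' = Suc (Suc (card (\<P> - {D})))" using U_new F(3) by (simp add: \<P>'_def)
          also have "Suc (card (\<P> - {D})) = card \<P>" using DP F(3) by (rule card_Suc_Diff1[rotated])
          finally show ?thesis .
        qed
        ultimately show False using max by fastforce
      qed
    qed
    have fin: "finite (\<Union> {P \<in> \<P>. finite P})" using F(3) by auto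
    have A_cover: "A \<subseteq> F' \<union> \<Union> \<D>" using F(4) by (auto simp: F'_def \<D>_def)
    show ?thesis
    proof (rule that[of F' \<D>])
      show "finite F'" using F(1) True fin by (simp add: F'_def)
      show "F' \<subseteq> A \<union> B" using F by (auto simp: F'_def full_def)
      show "finite \<D>" using F(3) by (simp add: \<D>_def)
      show "\<D> \<noteq> {}"
      proof
        assume "\<D> = {}"
        then have "A \<subseteq> F'" using A_cover by simp
        then show False using \<open>finite F'\<close> A finite_subset by blast
      qed
      show "disjoint \<D>" using F(6) by (rule pairwise_subset) (auto simp: \<D>_def)
      show "A \<subseteq> F' \<union> \<Union> \<D>" by (fact A_cover)
      show "infinite D \<and> D \<subseteq> A - F' \<and> inf_connected E (hull_in B E D) D" if D: "D \<in> \<D>" for D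
      proof (intro conjI conn D)
        show "infinite D" using D by (simp add: \<D>_def)
        have "D \<inter> P = {}" if "P \<in> \<P>" "finite P" for P
        proof -
          have "D \<in> \<P>" "D \<noteq> P" using D that by (auto simp: \<D>_def)
          then show ?thesis using pairwiseD[OF F(6), of D P] that by (simp add: disjnt_def)
        qed
        moreover have "D \<inter> full = {}" using D F(4) bip
            by (auto simp: \<D>_def full_def bipartite_graph_def)
        ultimately show "D \<subseteq> A - F'" using D F(4) by (auto simp: \<D>_def F'_def)
      qed
      fix b D assume b: "b \<in> B - F'" "D \<in> \<D>" "nbrs E b \<inter> D \<noteq> {}"
      then have "b \<in> B2" by (auto simp: B2_def F'_def)
      show "nbrs E b \<subseteq> D \<union> F'"
      proof
        fix a assume a: "a \<in> nbrs E b"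
        then have "a \<in> A" using b bipartite_nbrs_subset(1)[OF bip, of b] by blast
        show "a \<in> D \<union> F'"
        proof (rule ccontr)
          assume "a \<notin> D \<union> F'"
          then obtain D' where "D' \<in> \<D>" "a \<in> D'" using A_cover \<open>a \<in> A\<close> by blast
          then show False using cross[OF \<open>b \<in> B2\<close>, of D D'] a b(2,3) \<open>a \<notin> D \<union> F'\<close>
              by (auto simp: \<D>_def)
        qed
      qed
    qed
  qed
qed

section \<open>Finite cycles\<close>

text \<open>A finite dHp subgraph is cut out of \<open>G\<close>: for each of the finitely many sets
  \<open>Y \<subseteq> X\<close> with at least two elements, an injection of \<open>Y\<close> into
  its \<open>N2\<close> is fixed, and \<open>B\<close> is restricted to the images. Renaming by
  natural numbers brings it under \<open>finite_case\<close>.\<close>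

lemma finite_cycle_through:
  assumes finite_case:
      "\<forall>(A\<^sub>H :: nat set) B\<^sub>H E\<^sub>H X.
         finite (A\<^sub>H \<union> B\<^sub>H) \<and> dHp_graph A\<^sub>H B\<^sub>H E\<^sub>H \<and> X \<subseteq> A\<^sub>H \<and> 2 \<le> card X \<longrightarrow>
         (\<exists>c. finite_cycle E\<^sub>H c \<and> set c \<inter> A\<^sub>H = X)"
    and dHp: "dHp_graph A B E" and X: "X \<subseteq> A" "finite X" "2 \<le> card X"
  obtains c where "finite_cycle E c" "set c \<inter> A = X"
proof -
  have bip: "bipartite_graph A B E" using dHp by (simp add: dHp_graph_def)
  have "\<exists>f. inj_on f Y \<and> f ` Y \<subseteq> N2 (A \<union> B) E Y" if "Y \<subseteq> X" "at_least_two Y" for Y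
    using dHp that X(1) unfolding dHp_graph_def lepoll_def by blast
  then obtain f where f: "\<And>Y. Y \<subseteq> X \<Longrightarrow> at_least_two Y \<Longrightarrow> inj_on (f Y) Y"
      "\<And>Y. Y \<subseteq> X \<Longrightarrow> at_least_two Y \<Longrightarrow> f Y ` Y \<subseteq> N2 (A \<union> B) E Y" by metis
  have N2_B: "v \<in> B" if "v \<in> N2 (A \<union> B) E Y" "Y \<subseteq> X" for v Y
  proof (rule ccontr)
    assume "v \<notin> B"
    then have "v \<in> A" "nbrs E v \<inter> Y \<noteq> {}" using that by (auto simp: N2_def at_least_two_def)
    then show False
        using bipartite_nbrs_subset(2)[OF bip] that(2) X(1) bip unfolding bipartite_graph_def
        by blast
  qed
  define BH where "BH = (\<Union>Y\<in>{Y. Y \<subseteq> X \<and> at_least_two Y}. f Y ` Y)"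
  have BH: "finite BH" "BH \<subseteq> B"
  proof -
    have "finite {Y. Y \<subseteq> X \<and> at_least_two Y}" using X(2)
        by (rule finite_subset[rotated, OF finite_Pow_iff[THEN iffD2]]) auto
    then show "finite BH" unfolding BH_def using X(2) by (auto intro: finite_subset)
    show "BH \<subseteq> B" unfolding BH_def using f(2) N2_B by blast
  qed
  have XB: "X \<inter> BH = {}" "X \<inter> B = {}" "A \<inter> BH = {}" using X(1) BH bip
      by (auto simp: bipartite_graph_def)
  obtain \<phi> :: "'a \<Rightarrow> nat" where \<phi>: "inj_on \<phi> (X \<union> BH)"
    using finite_imp_inj_to_nat_seg[of "X \<union> BH"] X(2) BH(1) by blast
  define \<psi> where "\<psi> = inv_into (X \<union> BH) \<phi>"
  have \<psi>: "\<psi> (\<phi> v) = v" if "v \<in> X \<union> BH" for v unfolding \<psi>_def by (rule inv_into_f_f[OF \<phi> that])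
  define E' where "E' = {{\<phi> a, \<phi> b} | a b. a \<in> X \<and> b \<in> BH \<and> {a, b} \<in> E}"
  have two: "at_least_two X" using X card_le_Suc0_iff_eq[of X] by (auto simp: at_least_two_def)
  have bip': "bipartite_graph (\<phi> ` X) (\<phi> ` BH) E'"
  proof -
    have "\<phi> ` X \<inter> \<phi> ` BH = {}" using \<phi> XB(1)
        by (metis Un_upper1 Un_upper2 image_empty inj_on_image_Int)
    then show ?thesis unfolding bipartite_graph_def E'_def by blast
  qed
  have dHp': "dHp_graph (\<phi> ` X) (\<phi> ` BH) E'"
    unfolding dHp_graph_def
  proof (intro conjI allI impI bip')
    have "inj_on \<phi> X" using \<phi> by (rule inj_on_subset) simp
    then show "at_least_two (\<phi> ` X)" using two by (auto simp: at_least_two_def inj_on_def)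
    fix Y' assume Y': "Y' \<subseteq> \<phi> ` X \<and> at_least_two Y'"
    define Y where "Y = {x \<in> X. \<phi> x \<in> Y'}"
    have Y: "Y \<subseteq> X" "Y' = \<phi> ` Y" using Y' by (auto simp: Y_def)
    obtain u v where uv: "u \<in> Y'" "v \<in> Y'" "u \<noteq> v" using Y' unfolding at_least_two_def by blast
    then obtain a b where ab: "a \<in> Y" "b \<in> Y" "u = \<phi> a" "v = \<phi> b" unfolding Y(2) by blast
    then have "a \<noteq> b" using uv(3) by auto
    then have Y2: "at_least_two Y" unfolding at_least_two_def using ab(1,2) by (intro bexI)
    have fY: "f Y ` Y \<subseteq> BH" using Y Y2 by (auto simp: BH_def)
    have "Y' \<lesssim> Y" unfolding Y(2) by (rule image_lepoll)
    also have "Y \<lesssim> N2 (\<phi> ` X \<union> \<phi> ` BH) E' Y'"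
      unfolding lepoll_def
    proof (intro exI conjI)
      show "inj_on (\<phi> \<circ> f Y) Y"
        using f(1)[OF Y(1) Y2] inj_on_subset[OF \<phi>, of "f Y ` Y"] fY by (intro comp_inj_on) auto
      show "(\<phi> \<circ> f Y) ` Y \<subseteq> N2 (\<phi> ` X \<union> \<phi> ` BH) E' Y'"
      proof (rule image_subsetI)
        fix y assume y: "y \<in> Y"
        define v where "v = f Y y"
        have v: "v \<in> BH" "v \<in> N2 (A \<union> B) E Y" using fY f(2)[OF Y(1) Y2] y by (auto simp: v_def)
        then obtain a b where ab: "a \<in> Y" "b \<in> Y" "a \<noteq> b" "{a, v} \<in> E" "{b, v} \<in> E"
          by (auto simp: N2_def at_least_two_def nbrs_def)
        then have "{\<phi> a, \<phi> v} \<in> E'" "{\<phi> b, \<phi> v} \<in> E'" using Y(1) v(1) unfolding E'_def by blast+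
        moreover have "\<phi> a \<noteq> \<phi> b" using ab Y(1) \<phi> by (auto simp: inj_on_def)
        ultimately show "(\<phi> \<circ> f Y) y \<in> N2 (\<phi> ` X \<union> \<phi> ` BH) E' Y'"
          using ab v(1) unfolding Y(2) by (auto simp: N2_def at_least_two_def nbrs_def v_def)
      qed
    qed
    finally show "Y' \<lesssim> N2 (\<phi> ` X \<union> \<phi> ` BH) E' Y'" .
  qed
  have "card (\<phi> ` X) = card X" using inj_on_subset[OF \<phi>, of X] by (simp add: card_image)
  moreover have "finite (\<phi> ` X \<union> \<phi> ` BH)" using X BH by simp
  ultimately obtain c where c: "finite_cycle E' c" "set c \<inter> \<phi> ` X = \<phi> ` X"
    using finite_case[rule_format, of "\<phi> ` X" "\<phi> ` BH" E' "\<phi> ` X"] dHp' X(3) by auto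
  have len: "3 \<le> length c" "distinct c"
    and edge: "\<And>i. i < length c \<Longrightarrow> {c ! i, c ! (Suc i mod length c)} \<in> E'"
    using c(1) by (auto simp: finite_cycle_def)
  have cV: "set c \<subseteq> \<phi> ` (X \<union> BH)"
  proof
    fix v assume "v \<in> set c"
    then obtain i where "i < length c" "v = c ! i" by (metis in_set_conv_nth)
    then show "v \<in> \<phi> ` (X \<union> BH)" using edge[of i] unfolding E'_def by (auto simp: doubleton_eq_iff)
  qed
  show ?thesis
  proof
    show "finite_cycle E (map \<psi> c)"
      unfolding finite_cycle_def
    proof (intro conjI allI impI)
      show "3 \<le> length (map \<psi> c)" using len by simp
      have "inj_on \<psi> (set c)" unfolding \<psi>_def by (rule inj_on_inv_into[OF cV])
      then show "distinct (map \<psi> c)" using len by (simp add: distinct_map)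
      fix i assume "i < length (map \<psi> c)"
      then have i: "i < length c" "Suc i mod length c < length c" using len
          by (auto intro: mod_less_divisor)
      obtain a b where ab: "{c ! i, c ! (Suc i mod length c)} = {\<phi> a, \<phi> b}" "a \<in> X" "b \<in> BH"
          "{a, b} \<in> E"
        using edge[OF i(1)] unfolding E'_def by blast
      have "\<psi> ` {c ! i, c ! (Suc i mod length c)} = {a, b}" unfolding ab(1) using \<psi> ab by simp
      then show "{map \<psi> c ! i, map \<psi> c ! (Suc i mod length (map \<psi> c))} \<in> E" using i ab(4) by simp
    qed
    have "\<psi> ` set c \<subseteq> X \<union> BH" using cV \<psi> by force
    moreover have "X \<subseteq> \<psi> ` set c"
    proof
      fix x assume x: "x \<in> X"
      then have "\<phi> x \<in> set c" using c(2) by blast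
      then show "x \<in> \<psi> ` set c" using \<psi>[of x] x by (metis UnI1 image_eqI)
    qed
    ultimately show "set (map \<psi> c) \<inter> A = X" using XB X(1) by auto
  qed
qed

lemma finite_cycle_unrolled:
  assumes "finite_cycle E c"
  obtains L :: int and z :: "int \<Rightarrow> 'a" where "L \<ge> 3" "\<And>i j. z i = z j \<longleftrightarrow> L dvd i - j"
    "\<And>i. {z i, z (i + 1)} \<in> E" "range z = set c"
proof
  let ?L = "int (length c)" and ?z = "\<lambda>i. c ! nat (i mod int (length c))"
  have c: "3 \<le> length c" "distinct c" "\<And>i. i < length c \<Longrightarrow> {c ! i, c ! (Suc i mod length c)} \<in> E"
    using assms by (auto simp: finite_cycle_def)
  show "?L \<ge> 3" using c(1) by simp
  have mod_bd: "0 \<le> i mod ?L" "i mod ?L < ?L" for i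
  proof -
    have "?L > 0" using c(1) by linarith
    then show "0 \<le> i mod ?L" "i mod ?L < ?L" by (rule pos_mod_sign, rule pos_mod_bound)
  qed
  have bd: "nat (i mod ?L) < length c" for i using mod_bd[of i] by linarith
  show "?z i = ?z j \<longleftrightarrow> ?L dvd i - j" for i j
  proof -
    have "?z i = ?z j \<longleftrightarrow> nat (i mod ?L) = nat (j mod ?L)"
      using c(2) bd by (simp add: nth_eq_iff_index_eq)
    also have "\<dots> \<longleftrightarrow> i mod ?L = j mod ?L" using mod_bd[of i] mod_bd[of j] by linarith
    finally show ?thesis by (simp add: mod_eq_dvd_iff)
  qed
  show "{?z i, ?z (i + 1)} \<in> E" for i
  proof -
    have "int (Suc (nat (i mod ?L)) mod length c) = (i mod ?L + 1) mod ?L" using mod_bd[of i]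
        by (simp add: zmod_int add.commute)
    also have "\<dots> = (i + 1) mod ?L" by (simp add: mod_add_left_eq)
    finally have "Suc (nat (i mod ?L)) mod length c = nat ((i + 1) mod ?L)" by simp
    then show ?thesis using c(3)[OF bd[of i]] by simp
  qed
  show "range ?z = set c"
  proof
    show "range ?z \<subseteq> set c" using bd by auto
    show "set c \<subseteq> range ?z"
    proof
      fix v assume "v \<in> set c"
      then obtain i where "i < length c" "v = c ! i" by (metis in_set_conv_nth)
      then have "v = ?z (int i)" by simp
      then show "v \<in> range ?z" by blast
    qed
  qed
qed

section \<open>Cutting a finite cycle open\<close>

lemma strict_mono_int_step:
  fixes q :: "int \<Rightarrow> int" assumes "\<And>i. q i < q (i + 1)" shows "strict_mono q"
proof (rule strict_monoI)
  fix i j :: int assume "i < j"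
  then show "q i < q j"
  proof (induction rule: int_gr_induct)
    case (step j) then show ?case using assms[of j] by linarith
  qed (rule assms)
qed

lemma strict_mono_int_bracket:
  fixes q :: "int \<Rightarrow> int" assumes "strict_mono q"
  obtains i where "q i \<le> x" "x < q (i + 1)"
proof -
  have s: "q i < q (i + 1)" for i using assms by (simp add: strict_mono_def)
  have "\<exists>i. q i \<le> x \<and> x < q (i + 1)"
  proof (induction x rule: int_induct[where k = "q 0"])
    case base show ?case using s[of 0] by (intro exI[of _ 0]) simp
  next
    case (step1 x)
    then obtain i where i: "q i \<le> x" "x < q (i + 1)" by blast
    show ?case
    proof (cases "x + 1 < q (i + 1)")
      case True then show ?thesis using i by (intro exI[of _ i]) simp
    next
      case False then show ?thesis using i s[of "i + 1"] by (intro exI[of _ "i + 1"]) simp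
    qed
  next
    case (step2 x)
    then obtain i where i: "q i \<le> x" "x < q (i + 1)" by blast
    show ?case
    proof (cases "q i \<le> x - 1")
      case True then show ?thesis using i by (intro exI[of _ i]) simp
    next
      case False then show ?thesis using i s[of "i - 1"] by (intro exI[of _ "i - 1"]) simp
    qed
  qed
  then show ?thesis using that by blast
qed

text \<open>All integers with residue in \<open>Q\<close> are listed in increasing order;
  \<open>m\<close> steps in the list make one full turn of length \<open>L\<close>.\<close>

lemma cyclic_enumeration:
  fixes Q :: "int set"
  assumes Q: "finite Q" "Q \<noteq> {}" "Q \<subseteq> {0..<L}"
  obtains m q where "m > 0" "strict_mono q" "\<And>i k. q (i + k * m) = q i + k * L"
    "\<And>x. x mod L \<in> Q \<longleftrightarrow> x \<in> range q"
proof -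
  define xs where "xs = sorted_list_of_set Q"
  define m where "m = int (length xs)"
  define q where "q = (\<lambda>i. xs ! nat (i mod m) + L * (i div m))"
  have xs: "set xs = Q" "sorted_wrt (<) xs" using Q(1) by (auto simp: xs_def)
  have m: "m > 0" using Q xs(1) by (auto simp: m_def)
  have L: "L > 0" using Q(2,3) by force
  have mod_bd: "0 \<le> i mod m" "i mod m < m" for i using m by (rule pos_mod_sign, rule pos_mod_bound)
  have idx: "nat (i mod m) < length xs" for i using mod_bd[of i] m_def by linarith
  have nth_Q: "xs ! k \<in> Q" "0 \<le> xs ! k" "xs ! k < L" if "k < length xs" for k
    using nth_mem[OF that] xs(1) Q(3) by auto
  have "q i < q (i + 1)" for i
  proof (cases "i mod m + 1 < m")
    case True
    have "(i + 1) mod m = (i mod m + 1) mod m" by (simp add: mod_add_left_eq)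
    then have eq: "(i + 1) mod m = i mod m + 1" using True mod_bd[of i] by simp
    moreover have "i = m * (i div m) + i mod m" "i + 1 = m * ((i + 1) div m) + (i + 1) mod m"
        by simp_all
    ultimately have "m * ((i + 1) div m) = m * (i div m)" by linarith
    then have dv: "(i + 1) div m = i div m" using m by simp
    have "xs ! nat (i mod m) < xs ! nat ((i + 1) mod m)"
      by (rule sorted_wrt_nth_less[OF xs(2)]) (use eq idx[of "i + 1"] mod_bd[of i] in auto)
    then show ?thesis by (simp add: q_def dv)
  next
    case False
    \<comment> \<open>At the last residue of a turn, the successor is the first residue shifted by
      \<open>L\<close>.\<close>
    then have i: "i mod m = m - 1" using mod_bd[of i] by linarith
    have "m * (i div m) + i mod m = i" by (rule mult_div_mod_eq)
    then have "i + 1 = m * (i div m + 1)" unfolding distrib_left i by linarith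
    then have "(i + 1) mod m = 0" "(i + 1) div m = i div m + 1" using m by simp_all
    then have "q (i + 1) = xs ! 0 + L * (i div m) + L" by (simp add: q_def algebra_simps)
    moreover have "xs ! nat (i mod m) < L" "0 \<le> xs ! 0" using nth_Q idx[of i] by force+
    ultimately show ?thesis by (simp add: q_def)
  qed
  then have "strict_mono q" by (rule strict_mono_int_step)
  moreover have "q (i + k * m) = q i + k * L" for i k using m by (simp add: q_def algebra_simps)
  moreover have "x mod L \<in> Q \<longleftrightarrow> x \<in> range q" for x
  proof
    assume "x mod L \<in> Q"
    then obtain k where k: "k < length xs" "x mod L = xs ! k" using xs(1) by (metis in_set_conv_nth)
    then have "(int k + m * (x div L)) mod m = int k" "(int k + m * (x div L)) div m = x div L"
      using m by (simp_all add: m_def)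
    then have "q (int k + m * (x div L)) = x mod L + L * (x div L)" using k(2)
        by (simp only: q_def nat_int)
    then have "q (int k + m * (x div L)) = x" by simp
    then show "x \<in> range q" by (metis rangeI)
  next
    assume "x \<in> range q"
    then obtain i where "x = xs ! nat (i mod m) + L * (i div m)" by (auto simp: q_def)
    then have "x mod L = xs ! nat (i mod m) mod L" by simp
    then have "x mod L = xs ! nat (i mod m)" using nth_Q[OF idx[of i]] by simp
    then show "x mod L \<in> Q" using nth_Q[OF idx[of i]] by simp
  qed
  ultimately show ?thesis using that m by blast
qed

text \<open>The vertex at position \<open>\<kappa> D\<close> is removed, and \<open>R D\<close> and
  \<open>R' D\<close> start at its predecessor and successor. The segment between two consecutive
  cuts, with the ray \<open>R'\<close> of the first and the ray \<open>R\<close> of the second,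
  forms one double ray.\<close>

lemma cycle_from_cut_cycle:
  fixes z :: "int \<Rightarrow> 'a" and \<D> :: "'b set" and \<kappa> :: "'b \<Rightarrow> int" and R R' :: "'b \<Rightarrow> nat \<Rightarrow> 'a"
  assumes simple: "simple_graph V E" and L: "L > 0"
    and z_eq: "\<And>i j. z i = z j \<longleftrightarrow> L dvd i - j" and z_edge: "\<And>i. {z i, z (i + 1)} \<in> E"
    and \<D>: "finite \<D>" "\<D> \<noteq> {}"
    and rays: "\<And>D. D \<in> \<D> \<Longrightarrow> R D \<in> rays E \<and> R' D \<in> rays E"
    and start: "\<And>D. D \<in> \<D> \<Longrightarrow> R D 0 = z (\<kappa> D - 1)" "\<And>D. D \<in> \<D> \<Longrightarrow> R' D 0 = z (\<kappa> D + 1)"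
    and disj: "\<And>D. D \<in> \<D> \<Longrightarrow> range (R D) \<inter> range (R' D) = {}"
    and meet: "\<And>D. D \<in> \<D> \<Longrightarrow> (range (R D) \<union> range (R' D)) \<inter> range z \<subseteq> {R D 0, R' D 0}"
    and disj': "\<And>D D'. D \<in> \<D> \<Longrightarrow> D' \<in> \<D> \<Longrightarrow> D \<noteq> D' \<Longrightarrow>
      (range (R D) \<union> range (R' D)) \<inter> (range (R D') \<union> range (R' D')) = {}"
    and cuts: "\<And>D D'. D \<in> \<D> \<Longrightarrow> D' \<in> \<D> \<Longrightarrow> L dvd \<kappa> D - \<kappa> D' \<Longrightarrow> D = D'"
      "\<And>D D'. D \<in> \<D> \<Longrightarrow> D' \<in> \<D> \<Longrightarrow> \<not> L dvd \<kappa> D - \<kappa> D' - 1"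
    and equiv: "\<And>D. D \<in> \<D> \<Longrightarrow> (R D, R' D) \<in> ray_equiv V E"
    and F0: "finite F0" "F0 \<subseteq> V"
    and sep: "\<And>D D' F. D \<in> \<D> \<Longrightarrow> D' \<in> \<D> \<Longrightarrow> finite F \<Longrightarrow> F0 \<subseteq> F \<Longrightarrow> F \<subseteq> V \<Longrightarrow>
      end_component V E F (end_of V E (R D)) = end_component V E F (end_of V E (R D')) \<Longrightarrow> D = D'"
  shows "\<exists>Z. is_cycle V E Z \<and> range z - z ` \<kappa> ` \<D> \<subseteq> fst Z \<and>
      (\<forall>D\<in>\<D>. range (R D) \<union> range (R' D) \<subseteq> fst Z)"
proof -
  define Q where "Q = (\<lambda>D. \<kappa> D mod L) ` \<D>"
  have "finite Q" "Q \<noteq> {}" "Q \<subseteq> {0..<L}" using \<D> L by (auto simp: Q_def)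
  then obtain m q
      where m: "m > 0" and q: "strict_mono q" and q_per: "\<And>i k. q (i + k * m) = q i + k * L"
    and q_range: "\<And>x. x mod L \<in> Q \<longleftrightarrow> x \<in> range q" using cyclic_enumeration by blast
  have q_eq: "q i = q j \<longleftrightarrow> i = j" and q_less: "q i < q j \<longleftrightarrow> i < j" for i j
    using q by (simp_all add: strict_mono_eq strict_mono_less)
  have "\<exists>D\<in>\<D>. L dvd q i - \<kappa> D" for i
  proof -
    have "q i mod L \<in> Q" using q_range by blast
    then show ?thesis by (auto simp: Q_def mod_eq_dvd_iff)
  qed
  \<comment> \<open>The part whose cut is at position \<open>q i\<close>; the index is determined by
    it modulo \<open>m\<close>.\<close>
  then obtain \<delta> where \<delta>: "\<And>i. \<delta> i \<in> \<D>" "\<And>i. L dvd q i - \<kappa> (\<delta> i)" by metis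
  have q_dvd: "L dvd q i - q j \<Longrightarrow> m dvd i - j" for i j
  proof -
    assume "L dvd q i - q j"
    then obtain k where "q i = q j + k * L" by (auto simp: dvd_def algebra_simps)
    then have "q i = q (j + k * m)" using q_per by simp
    then have "i = j + k * m" using q_eq by blast
    then show "m dvd i - j" by simp
  qed
  have \<delta>_eq: "\<delta> i = \<delta> j \<longleftrightarrow> m dvd i - j" for i j
  proof
    assume "\<delta> i = \<delta> j"
    then have "L dvd (q i - \<kappa> (\<delta> i)) - (q j - \<kappa> (\<delta> i))" using \<delta>(2)[of i] \<delta>(2)[of j] dvd_diff
        by metis
    then show "m dvd i - j" using q_dvd by simp
  next
    assume "m dvd i - j"
    then obtain k where "i = j + k * m" by (auto simp: dvd_def algebra_simps)
    then have qi: "q i = q j + k * L" using q_per by simp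
    have "L dvd (q j - \<kappa> (\<delta> j)) + k * L - (q i - \<kappa> (\<delta> i))"
      by (rule dvd_diff[OF dvd_add[OF \<delta>(2) dvd_triv_right] \<delta>(2)])
    then have "L dvd \<kappa> (\<delta> i) - \<kappa> (\<delta> j)" using qi by (simp add: algebra_simps)
    then show "\<delta> i = \<delta> j" using cuts(1) \<delta>(1) by blast
  qed
  have \<delta>_surj: "\<exists>i. \<delta> i = D" if D: "D \<in> \<D>" for D
  proof -
    have "\<kappa> D mod L \<in> Q" using D by (auto simp: Q_def)
    then obtain i where "\<kappa> D = q i" using q_range by blast
    then have "L dvd \<kappa> D - \<kappa> (\<delta> i)" using \<delta>(2) by metis
    then show ?thesis using cuts(1)[OF D \<delta>(1)] by metis
  qed
  define d where "d = (\<lambda>i. q (i + 1) - q i)"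
  \<comment> \<open>No two cuts are neighbours on the cycle, so a vertex remains between consecutive
    ones.\<close>
  have d2: "d i \<ge> 2" for i
  proof -
    have "d i \<ge> 1" using q_less[of i "i + 1"] by (simp add: d_def)
    moreover have "d i \<noteq> 1"
    proof
      assume "d i = 1"
      then have eq: "q (i + 1) = q i + 1" by (simp add: d_def)
      have "L dvd (q i - \<kappa> (\<delta> i)) - (q (i + 1) - \<kappa> (\<delta> (i + 1)))" by (rule dvd_diff[OF \<delta>(2) \<delta>(2)])
      then have "L dvd \<kappa> (\<delta> (i + 1)) - \<kappa> (\<delta> i) - 1" using eq by (simp add: algebra_simps)
      then show False using cuts(2) \<delta>(1) by blast
    qed
    ultimately show ?thesis by linarith
  qed
  have per: "\<delta> (i + m) = \<delta> i" "\<delta> (i + m + 1) = \<delta> (i + 1)" "d (i + m) = d i"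
      "z (q (i + m) + n) = z (q i + n)" for i n
  proof -
    show "\<delta> (i + m) = \<delta> i" "\<delta> (i + m + 1) = \<delta> (i + 1)" by (simp_all add: \<delta>_eq)
    have "q (i + m) = q i + L" "q (i + 1 + m) = q (i + 1) + L"
        using q_per[of i 1] q_per[of "i + 1" 1] by simp_all
    then show "d (i + m) = d i" "z (q (i + m) + n) = z (q i + n)"
        by (simp_all add: d_def z_eq algebra_simps)
  qed
  \<comment> \<open>Positions count from the cut \<open>q i\<close>: those strictly between 0 and
    \<open>d i\<close> lie on the cycle. The rays enter with entry 1 at positions 0 and
    \<open>d i\<close>, because their entries 0 are the cycle vertices at positions 1 and
    \<open>d i - 1\<close>.\<close>
  define p where "p = (\<lambda>i n. if n < 1 then R' (\<delta> i) (nat (1 - n)) else if n < d i then z (q i + n)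
    else R (\<delta> (i + 1)) (nat (n - d i + 1)))"
  have st: "R' (\<delta> i) 0 = z (q i + 1)" "R (\<delta> (i + 1)) 0 = z (q i + (d i - 1))" for i
  proof -
    show "R' (\<delta> i) 0 = z (q i + 1)"
      unfolding start(2)[OF \<delta>(1)] z_eq using \<delta>(2)[of i] by (simp add: dvd_diff_commute)
    show "R (\<delta> (i + 1)) 0 = z (q i + (d i - 1))"
      unfolding start(1)[OF \<delta>(1)] z_eq using \<delta>(2)[of "i + 1"] by (simp add: d_def dvd_diff_commute)
  qed
  have pL: "p i n = R' (\<delta> i) (nat (1 - n))" if "n \<le> 1" for i n
  proof (cases "n = 1")
    case True then show ?thesis using st(1)[of i] d2[of i] by (simp add: p_def)
  next
    case False then show ?thesis using that by (simp add: p_def)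
  qed
  have pR: "p i n = R (\<delta> (i + 1)) (nat (n - d i + 1))" if "n \<ge> d i - 1" for i n
  proof (cases "n = d i - 1")
    case True then show ?thesis using st(2)[of i] d2[of i] by (simp add: p_def)
  next
    case False then show ?thesis using that d2[of i] by (simp add: p_def)
  qed
  have pM: "p i n = z (q i + n)" if "1 \<le> n" "n < d i" for i n using that by (simp add: p_def)
  have ray_facts: "inj (R D)" "inj (R' D)" "\<And>n. {R D n, R D (Suc n)} \<in> E"
      "\<And>n. {R' D n, R' D (Suc n)} \<in> E"
    if "D \<in> \<D>" for D using rays[OF that] by (auto simp: rays_def)
  have off: "R D (Suc k) \<notin> range z" "R' D (Suc k) \<notin> range z" if D: "D \<in> \<D>" for D k
  proof -
    have "R D (Suc k) \<noteq> R D 0" "R' D (Suc k) \<noteq> R' D 0" using ray_facts(1,2)[OF D]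
        by (auto dest: injD)
    moreover have "R D (Suc k) \<noteq> R' D 0" "R' D (Suc k) \<noteq> R D 0" using disj[OF D]
        by (auto simp: disjoint_iff)
    ultimately show "R D (Suc k) \<notin> range z" "R' D (Suc k) \<notin> range z" using meet[OF D] by blast+
  qed
  have offL: "p i n \<notin> range z" if "n < 1" for i n
  proof -
    have "nat (1 - n) = Suc (nat (- n))" using that by simp
    then show ?thesis using pL[of n i] off(2)[OF \<delta>(1)] that by simp
  qed
  have offR: "p i n \<notin> range z" if "n \<ge> d i" for i n
  proof -
    have "nat (n - d i + 1) = Suc (nat (n - d i))" using that by simp
    then show ?thesis using pR[of i n] off(1)[OF \<delta>(1)] that by simp
  qed
  have same: "D = D'" if "D \<in> \<D>" "D' \<in> \<D>" "v \<in> range (R D) \<union> range (R' D)"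
      "v \<in> range (R D') \<union> range (R' D')" for D D' v
    using disj'[OF that(1,2)] that(3,4) by blast
  have RR': "R D k \<noteq> R' D' k'" if DD: "D \<in> \<D>" "D' \<in> \<D>" for D D' k k'
  proof
    assume eq: "R D k = R' D' k'"
    have "D = D'" by (rule same[OF DD, of "R D k"], blast) (simp add: eq)
    then have "R D k \<in> range (R' D)" using eq by simp
    then show False using disj[OF DD(1)] by blast
  qed
  have R_eq: "D = D' \<and> k = k'" if DD: "D \<in> \<D>" "D' \<in> \<D>" and eq: "R D k = R D' k'" for D D' k k'
  proof -
    have "D = D'" by (rule same[OF DD, of "R D k"], blast) (simp add: eq)
    then show ?thesis using injD[OF ray_facts(1)[OF DD(1)], of k k'] eq by simp
  qed
  have R'_eq: "D = D' \<and> k = k'" if DD: "D \<in> \<D>" "D' \<in> \<D>" and eq: "R' D k = R' D' k'" for D D' k k'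
  proof -
    have "D = D'" by (rule same[OF DD, of "R' D k"], blast) (simp add: eq)
    then show ?thesis using injD[OF ray_facts(2)[OF DD(1)], of k k'] eq by simp
  qed
  have d_cong: "d i = d j" if "m dvd i - j" for i j
  proof -
    obtain k where "i = j + k * m" using \<open>m dvd i - j\<close> by (auto simp: dvd_def algebra_simps)
    then show ?thesis using q_per[of j k] q_per[of "j + 1" k] by (simp add: d_def algebra_simps)
  qed
  have p_inj: "n = n' \<and> m dvd i - j" if eq: "p i n = p j n'" for i j n n'
  proof -
    consider (l) "n < 1" "n' < 1" | (r) "n \<ge> d i" "n' \<ge> d j" | (m) "1 \<le> n" "n < d i" "1 \<le> n'"
        "n' < d j"
      | (lr) "n < 1" "n' \<ge> d j" | (rl) "n \<ge> d i" "n' < 1"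
      | (lm) "n < 1" "1 \<le> n'" "n' < d j" | (ml) "1 \<le> n" "n < d i" "n' < 1"
      | (rm) "n \<ge> d i" "1 \<le> n'" "n' < d j" | (mr) "1 \<le> n" "n < d i" "n' \<ge> d j" by linarith
    then show ?thesis
    proof cases
      case l
      then have "\<delta> i = \<delta> j" "nat (1 - n) = nat (1 - n')" using eq pL R'_eq[OF \<delta>(1) \<delta>(1)] by auto
      then show ?thesis using l \<delta>_eq by auto
    next
      case r
      then have *: "\<delta> (i + 1) = \<delta> (j + 1)" "nat (n - d i + 1) = nat (n' - d j + 1)"
        using eq pR[of i n] pR[of j n'] R_eq[OF \<delta>(1) \<delta>(1)] by auto
      then have "m dvd i - j" using \<delta>_eq[of "i + 1" "j + 1"] by simp
      then show ?thesis using d_cong *(2) r by auto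
    next
      case m
      then have "z (q i + n) = z (q j + n')" using eq pM by simp
      \<comment> \<open>After shifting by \<open>k\<close> turns, both positions are the same
        integer. It lies between one pair of consecutive cuts only, which forces the indices to
        agree.\<close>
      then obtain k where k: "q i + n = q j + n' + k * L" unfolding z_eq
          by (auto simp: dvd_def algebra_simps)
      have "q (j + k * m) + n' = q i + n" using k q_per by simp
      moreover have "q (j + k * m + 1) = q (j + k * m) + d j"
        using q_per[of "j + 1" k] q_per[of j k] by (simp add: d_def algebra_simps)
      moreover have "q (i + 1) = q i + d i" by (simp add: d_def)
      ultimately have "q i < q (j + k * m + 1)" "q (j + k * m) < q (i + 1)" using m by linarith+
      then have "i = j + k * m" using q_less by simp
      then show ?thesis using k q_per by simp
    next
      case lr
      then have "R' (\<delta> i) (nat (1 - n)) = R (\<delta> (j + 1)) (nat (n' - d j + 1))"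
        using eq pL[of n i] pR[of j n'] by simp
      then show ?thesis using RR'[OF \<delta>(1) \<delta>(1)] by metis
    next
      case rl
      then have "R (\<delta> (i + 1)) (nat (n - d i + 1)) = R' (\<delta> j) (nat (1 - n'))"
        using eq pL[of n' j] pR[of i n] by simp
      then show ?thesis using RR'[OF \<delta>(1) \<delta>(1)] by metis
    next
      case lm then show ?thesis using eq offL[of n i] pM[of n' j] by simp
    next
      case ml then show ?thesis using eq[symmetric] offL[of n' j] pM[of n i] by simp
    next
      case rm then show ?thesis using eq offR[of i n] pM[of n' j] by simp
    next
      case mr then show ?thesis using eq[symmetric] offR[of j n'] pM[of n i] by simp
    qed
  qed
  have p_edge: "{p i n, p i (n + 1)} \<in> E" for i n
  proof -
    consider "n \<le> 0" | "1 \<le> n" "n + 1 < d i" | "n \<ge> d i - 1" by linarith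
    then show ?thesis
    proof cases
      case 1
      then have "nat (1 - n) = Suc (nat (1 - (n + 1)))" by simp
      then have "p i n = R' (\<delta> i) (Suc (nat (1 - (n + 1))))"
          "p i (n + 1) = R' (\<delta> i) (nat (1 - (n + 1)))"
        using pL[of n i] pL[of "n + 1" i] 1 by simp_all
      then show ?thesis using ray_facts(4)[OF \<delta>(1)] by (metis insert_commute)
    next
      case 2
      then show ?thesis using pM[of n i] pM[of "n + 1" i] z_edge[of "q i + n"]
          by (simp add: add.assoc)
    next
      case 3
      then have "nat (n + 1 - d i + 1) = Suc (nat (n - d i + 1))" by simp
      then have "p i (n + 1) = R (\<delta> (i + 1)) (Suc (nat (n - d i + 1)))"
          "p i n = R (\<delta> (i + 1)) (nat (n - d i + 1))"
        using pR[of i n] pR[of i "n + 1"] 3 by simp_all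
      then show ?thesis using ray_facts(3)[OF \<delta>(1)] by metis
    qed
  qed
  define \<epsilon> where "\<epsilon> = (\<lambda>i. end_of V E (R (\<delta> i)))"
  \<comment> \<open>The two rays of a part are equivalent, so the tail of one double ray and the
    head of the next converge to the same end.\<close>
  have \<epsilon>': "\<epsilon> i = end_of V E (R' (\<delta> i))" for i
    unfolding \<epsilon>_def by (rule end_of_eqI[OF simple equiv[OF \<delta>(1)]])
  interpret double_ray_circle V E m p \<epsilon> F0
  proof
    show "p (i + m) = p i" for i by (simp add: fun_eq_iff p_def per)
    show "\<epsilon> i \<in> ends V E" for i using rays[OF \<delta>(1)] by (simp add: \<epsilon>_def end_of_in_ends)
    show "\<epsilon> (i + m) = \<epsilon> i" for i by (simp add: \<epsilon>_def per)
    fix F i assume F: "finite F" "F \<subseteq> V"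
    obtain k where k: "R (\<delta> (i + 1)) ` {k..} \<subseteq> end_component V E F (\<epsilon> (i + 1))"
      using end_component_is_component(2)[OF simple _ F, of "R (\<delta> (i + 1))"] rays[OF \<delta>(1)]
      unfolding \<epsilon>_def has_tail_in_def by blast
    have "p i n \<in> end_component V E F (\<epsilon> (i + 1))" if "n \<ge> d i + int k" for n
      using pR[of i n] k that by auto
    then show "\<exists>N. \<forall>n\<ge>N. p i n \<in> end_component V E F (\<epsilon> (i + 1))" by blast
    obtain k' where k': "R' (\<delta> i) ` {k'..} \<subseteq> end_component V E F (\<epsilon> i)"
      using end_component_is_component(2)[OF simple _ F, of "R' (\<delta> i)"] rays[OF \<delta>(1)]
      unfolding \<epsilon>' has_tail_in_def by blast
    have "p i n \<in> end_component V E F (\<epsilon> i)" if "n \<le> - int k'" for n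
      using pL[of n i] k' that by auto
    then show "\<exists>N. \<forall>n\<le>N. p i n \<in> end_component V E F (\<epsilon> i)" by blast
  next
    fix F i j assume "finite F" "F0 \<subseteq> F" "F \<subseteq> V"
        "end_component V E F (\<epsilon> i) = end_component V E F (\<epsilon> j)"
    then have "\<delta> i = \<delta> j" unfolding \<epsilon>_def by (intro sep[OF \<delta>(1) \<delta>(1)])
    then show "m dvd i - j" using \<delta>_eq by simp
  qed (use simple m p_inj p_edge F0 in auto)
  obtain Z where Z: "is_cycle V E Z" "range (case_prod p) \<subseteq> fst Z"
    using exists_cycle_through_double_rays by blast
  then have pZ: "p i n \<in> fst Z" for i n by auto
  have "range z - z ` \<kappa> ` \<D> \<subseteq> fst Z"
  proof
    fix v assume "v \<in> range z - z ` \<kappa> ` \<D>"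
    then obtain x where x: "v = z x" "v \<notin> z ` \<kappa> ` \<D>" by blast
    obtain i where i: "q i \<le> x" "x < q (i + 1)" using strict_mono_int_bracket[OF q] by blast
    have "x \<noteq> q i"
    proof
      assume "x = q i"
      then have "v = z (\<kappa> (\<delta> i))" using x(1) \<delta>(2) z_eq by simp
      then show False using x(2) \<delta>(1) by blast
    qed
    then have "v = p i (x - q i)" using pM[of "x - q i" i] i x(1) by (simp add: d_def)
    then show "v \<in> fst Z" using pZ by simp
  qed
  moreover have "range (R D) \<union> range (R' D) \<subseteq> fst Z" if D: "D \<in> \<D>" for D
  proof -
    obtain i where i: "\<delta> i = D" using \<delta>_surj[OF D] by blast
    have "R D k = p (i - 1) (d (i - 1) - 1 + int k)" "R' D k = p i (1 - int k)" for k
      using pR[of "i - 1" "d (i - 1) - 1 + int k"] pL[of "1 - int k" i] i by simp_all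
    then show ?thesis using pZ by auto
  qed
  ultimately show ?thesis using Z(1) by blast
qed

section \<open>Rays and ends within one part\<close>

lemma hull_in_disjoint:
  assumes "bipartite_graph A B E" "\<And>b. b \<in> B \<Longrightarrow> nbrs E b \<noteq> {}" "D \<subseteq> A" "D' \<subseteq> A" "D \<inter> D' = {}"
  shows "hull_in B E D \<inter> hull_in B E D' = {}"
  using assms unfolding hull_in_def bipartite_graph_def by blast

text \<open>Of two consecutive vertices of the ray one is in \<open>A\<close>, and the vertices of
  the hull that lie in \<open>A\<close> belong to \<open>D\<close>.\<close>

lemma ray_in_closure_hits:
  assumes bip: "bipartite_graph A B E" and D: "D \<subseteq> A" and r: "r \<in> rays E" "range r \<subseteq> hull_in B E D"
  obtains n where "n \<ge> k" "r n \<in> D"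
proof (cases "r k \<in> D")
  case False
  have "r k \<in> hull_in B E D" "r (Suc k) \<in> hull_in B E D" "{r k, r (Suc k)} \<in> E"
    using r by (auto simp: rays_def)
  then have "r (Suc k) \<in> D"
    using False bipartite_edge_cases[OF bip, of "r k" "r (Suc k)"] bip D
    by (auto simp: hull_in_def bipartite_graph_def)
  then show ?thesis using that[of "Suc k"] by simp
qed (use that[of k] in simp)

text \<open>Both rays return to \<open>D\<close> arbitrarily late, and what is left of
  \<open>D\<close> after deleting \<open>F\<close> lies in one component. Hence the rays inside the
  hull all belong to one end.\<close>

lemma rays_in_closure_equiv:
  assumes bip: "bipartite_graph A B E" and D: "D \<subseteq> A" and conn: "inf_connected E (hull_in B E D) D"
    and r: "r \<in> rays E" "range r \<subseteq> hull_in B E D" and s: "s \<in> rays E" "range s \<subseteq> hull_in B E D"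
  shows "(r, s) \<in> ray_equiv (A \<union> B) E"
  unfolding ray_equiv_def
proof (safe)
  fix F assume F: "finite F" "F \<subseteq> A \<union> B"
  have simple: "simple_graph (A \<union> B) E" by (rule bipartite_simple_graph[OF bip])
  obtain C where C: "C \<in> components_minus (A \<union> B) E F" "has_tail_in r C"
    using ray_tail_component[OF r(1) simple F(1)] by blast
  obtain C' where C': "C' \<in> components_minus (A \<union> B) E F" "has_tail_in s C'"
    using ray_tail_component[OF s(1) simple F(1)] by blast
  obtain k k' where k: "r ` {k..} \<subseteq> C" "s ` {k'..} \<subseteq> C'" using C C' by (auto simp: has_tail_in_def)
  obtain n where n: "n \<ge> k" "r n \<in> D" by (rule ray_in_closure_hits[OF bip D r])
  obtain n' where n': "n' \<ge> k'" "s n' \<in> D" by (rule ray_in_closure_hits[OF bip D s])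
  have in_C: "r n \<in> C" "s n' \<in> C'" using k n n' by auto
  then have "r n \<notin> F" "s n' \<notin> F" using component_subset[OF C(1)] component_subset[OF C'(1)] by auto
  then have "(r n, s n') \<in> connected_in E (hull_in B E D - F)"
    using conn F(1) n(2) n'(2) by (simp add: inf_connected_def)
  moreover have "hull_in B E D - F \<subseteq> A \<union> B - F" using D by (auto simp: hull_in_def)
  ultimately have "(r n, s n') \<in> connected_in E (A \<union> B - F)" using connected_in_mono by blast
  then have "s n' \<in> C" using component_closed[OF C(1) in_C(1)] by blast
  then have "C = C'" using component_unique[OF C(1) C'(1)] in_C by blast
  then show "\<exists>C\<in>components_minus (A \<union> B) E F. has_tail_in r C \<and> has_tail_in s C" using C C' by blast
qed (use r s in auto)

lemma connected_in_invariant: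
  assumes "(x, y) \<in> connected_in E W" "x \<in> U" "\<And>u v. u \<in> U \<Longrightarrow> v \<in> W \<Longrightarrow> {u, v} \<in> E \<Longrightarrow> v \<in> U"
  shows "y \<in> U"
proof -
  have "(x, y) \<in> {(x, y). x \<in> W \<and> y \<in> W \<and> {x, y} \<in> E}\<^sup>*" using assms(1)
      by (simp add: connected_in_def)
  then show ?thesis
    by (induction rule: rtrancl_induct) (use assms(2,3) in auto)
qed

text \<open>The set of \<open>D\<close> and its neighbours outside \<open>F\<close> is closed under
  edges of \<open>G\<close> that avoid \<open>F\<close>: from such a neighbour one gets only to
  \<open>D\<close> or \<open>F\<close>. A component avoiding \<open>F\<close> that meets
  \<open>D\<close> is therefore trapped in it.\<close>

lemma separated_parts:
  assumes bip: "bipartite_graph A B E" and D: "D \<subseteq> A" "D' \<subseteq> A" "D \<inter> D' = {}"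
    and sep: "\<And>b. b \<in> B - F \<Longrightarrow> nbrs E b \<inter> D \<noteq> {} \<Longrightarrow> nbrs E b \<subseteq> D \<union> F"
    and C: "C \<in> components_minus (A \<union> B) E F'" "F \<subseteq> F'" and x: "x \<in> C" "x \<in> D" and y: "y \<in> C"
        "y \<in> D'"
  shows False
proof -
  have "(x, y) \<in> connected_in E (A \<union> B - F')"
    using in_quotient_imp_in_rel[OF equiv_connected_in, of C "A \<union> B - F'" E x y] C(1) x y
    by (simp add: components_minus_def)
  moreover have "x \<in> D \<union> {b \<in> B - F. nbrs E b \<inter> D \<noteq> {}}" using x by simp
  ultimately have "y \<in> D \<union> {b \<in> B - F. nbrs E b \<inter> D \<noteq> {}}"
  proof (rule connected_in_invariant)
    fix u v assume u: "u \<in> D \<union> {b \<in> B - F. nbrs E b \<inter> D \<noteq> {}}" 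
      and v: "v \<in> A \<union> B - F'" and e: "{u, v} \<in> E"
    have vF: "v \<notin> F" using v C(2) by blast
    have uv: "u \<in> nbrs E v" "v \<in> nbrs E u" using e by (auto simp: nbrs_def insert_commute)
    show "v \<in> D \<union> {b \<in> B - F. nbrs E b \<inter> D \<noteq> {}}"
    proof (cases "u \<in> D")
      case True
      then have "v \<in> B" using bipartite_nbrs_subset(2)[OF bip, of u] D(1) uv(2) by blast
      then show ?thesis using True uv(1) vF by blast
    next
      case False
      then show ?thesis using u sep[of u] uv(2) vF by blast
    qed
  qed
  then show False using y D bip unfolding bipartite_graph_def by blast
qed

text \<open>A step of the cycle leaving \<open>D\<close> is charged to an element of \<open>F\<close>: to the vertex of \<open>A\<close> it
  reaches, or else to the vertex of \<open>B\<close> it uses.\<close>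

lemma cycle_stays_in_part:
  fixes z :: "int \<Rightarrow> 'a"
  assumes bip: "bipartite_graph A B E"
    and z_eq: "\<And>i j. z i = z j \<longleftrightarrow> L dvd i - j" and z_edge: "\<And>i. {z i, z (i + 1)} \<in> E"
    and D: "D \<subseteq> A" and F: "finite F"
    and sep: "\<And>b. b \<in> B - F \<Longrightarrow> nbrs E b \<inter> D \<noteq> {} \<Longrightarrow> nbrs E b \<subseteq> D \<union> F"
    and X: "X \<subseteq> D" "X \<subseteq> range z" "card F < card X"
  obtains k where "z (k - 1) \<in> D" "z k \<in> B" "z (k + 1) \<in> D"
proof (rule ccontr)
  assume "\<not> thesis"
  then have none: "\<not> (z (k - 1) \<in> D \<and> z k \<in> B \<and> z (k + 1) \<in> D)" for k using that by blast
  have AB: "A \<inter> B = {}" using bip by (simp add: bipartite_graph_def)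
  have "\<exists>k. z k = x" if "x \<in> X" for x using that X(2) by (metis imageE subsetD)
  then obtain \<iota> where \<iota>: "\<And>x. x \<in> X \<Longrightarrow> z (\<iota> x) = x" by metis
  have B1: "z (\<iota> x + 1) \<in> B" and A2: "z (\<iota> x + 2) \<in> A" and nb: "z (\<iota> x) \<in> nbrs E (z (\<iota> x + 1))"
      "z (\<iota> x + 2) \<in> nbrs E (z (\<iota> x + 1))"
    if "x \<in> X" for x
  proof -
    have "z (\<iota> x) \<in> A" using \<iota> X(1) D that by auto
    then show 1: "z (\<iota> x + 1) \<in> B" using bipartite_edge_cases[OF bip z_edge[of "\<iota> x"]] AB by blast
    have e: "{z (\<iota> x + 1), z (\<iota> x + 2)} \<in> E" using z_edge[of "\<iota> x + 1"] by (simp add: add.assoc)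
    then show "z (\<iota> x + 2) \<in> A" using bipartite_edge_cases[OF bip e] AB 1 by blast
    show "z (\<iota> x) \<in> nbrs E (z (\<iota> x + 1))" using z_edge[of "\<iota> x"] by (simp add: nbrs_def)
    show "z (\<iota> x + 2) \<in> nbrs E (z (\<iota> x + 1))" using e by (simp add: nbrs_def insert_commute)
  qed
  define g where "g = (\<lambda>x. if z (\<iota> x + 2) \<in> F then z (\<iota> x + 2) else z (\<iota> x + 1))"
  have "g ` X \<subseteq> F"
  proof (rule image_subsetI)
    fix x assume x: "x \<in> X"
    have "z (\<iota> x) \<in> D" using \<iota>[OF x] x X(1) by auto
    then have "z (\<iota> x + 2) \<notin> D" using none[of "\<iota> x + 1"] B1[OF x] by (simp add: add.assoc)
    then show "g x \<in> F"
      using sep[of "z (\<iota> x + 1)"] B1[OF x] nb[OF x] \<open>z (\<iota> x) \<in> D\<close> by (auto simp: g_def)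
  qed
  moreover have "inj_on g X"
  proof (rule inj_onI)
    fix x y assume xy: "x \<in> X" "y \<in> X" "g x = g y"
    \<comment> \<open>The two kinds of charges lie on different sides, so equal charges occur at
      equal offsets and determine the starting position modulo \<open>L\<close>.\<close>
    have "z (\<iota> x + 1) \<noteq> z (\<iota> y + 2)" "z (\<iota> x + 2) \<noteq> z (\<iota> y + 1)"
      using B1[OF xy(1)] B1[OF xy(2)] A2[OF xy(1)] A2[OF xy(2)] AB by auto
    then have "z (\<iota> x + 1) = z (\<iota> y + 1) \<or> z (\<iota> x + 2) = z (\<iota> y + 2)"
      using xy(3) by (auto simp: g_def split: if_splits)
    then have "z (\<iota> x) = z (\<iota> y)" by (auto simp: z_eq)
    then show "x = y" using \<iota> xy by metis
  qed
  ultimately have "card X \<le> card F" using card_inj_on_le[of g X F] F by blast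
  then show False using X(3) by simp
qed

section \<open>Assembling the circle from cycle and rays\<close>

theorem theorem3p8:
  fixes A B :: "'a set" and E :: "'a set set"
  assumes finite_case:
      "\<forall>(A\<^sub>H :: nat set) B\<^sub>H E\<^sub>H X.
         finite (A\<^sub>H \<union> B\<^sub>H) \<and> dHp_graph A\<^sub>H B\<^sub>H E\<^sub>H \<and> X \<subseteq> A\<^sub>H \<and> 2 \<le> card X \<longrightarrow>
         (\<exists>c. finite_cycle E\<^sub>H c \<and> set c \<inter> A\<^sub>H = X)"
    and "countable (A \<union> B)"
    and "infinite A" and "infinite B"
    and "dHp_graph A B E"
    and "\<forall>v\<in>B. card (nbrs E v) = 2 \<or> nbrs E v = A"
  shows "\<exists>Z. is_cycle (A \<union> B) E Z \<and> A \<subseteq> fst Z"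
proof -
  have bip: "bipartite_graph A B E" using assms(5) by (simp add: dHp_graph_def)
  have AB: "A \<inter> B = {}" using bip by (simp add: bipartite_graph_def)
  have simple: "simple_graph (A \<union> B) E" by (rule bipartite_simple_graph[OF bip])
  have nb_ne: "nbrs E b \<noteq> {}" if "b \<in> B" for b using assms(3,6) that by force
  obtain F \<D> where F: "finite F" "F \<subseteq> A \<union> B" and \<D>: "finite \<D>" "\<D> \<noteq> {}" "disjoint \<D>" "A \<subseteq> F \<union> \<Union> \<D>"
    and D: "\<And>D. D \<in> \<D> \<Longrightarrow> infinite D \<and> D \<subseteq> A - F \<and> inf_connected E (hull_in B E D) D"
    and sep: "\<And>b D. b \<in> B - F \<Longrightarrow> D \<in> \<D> \<Longrightarrow> nbrs E b \<inter> D \<noteq> {} \<Longrightarrow> nbrs E b \<subseteq> D \<union> F"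
    by (rule infinitely_connected_parts[OF assms(5,3) assms(6)[rule_format]]) (assumption, rule that)
  have D_disj: "D \<inter> D' = {}" if "D \<in> \<D>" "D' \<in> \<D>" "D \<noteq> D'" for D D'
    using pairwiseD[OF \<D>(3) that] by (simp add: disjnt_def)
  have DA: "D \<subseteq> A" if "D \<in> \<D>" for D using D that by blast
  \<comment> \<open>One more than \<open>card F\<close> forces the cycle to stay in \<open>D\<close>
    at some step; the second additional vertex makes \<open>X\<close> have two elements even if
    \<open>F\<close> is empty.\<close>
  have "\<exists>Y. finite Y \<and> card Y = card F + 2 \<and> Y \<subseteq> D" if "D \<in> \<D>" for D
    using D that by (intro infinite_arbitrarily_large) blast
  then obtain Y where Y: "\<And>D. D \<in> \<D> \<Longrightarrow> finite (Y D) \<and> card (Y D) = card F + 2 \<and> Y D \<subseteq> D" by metis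
  \<comment> \<open>The vertices of \<open>F \<inter> A\<close> lie in no part, so no ray can pick
    them up: the finite cycle itself must contain them.\<close>
  define X where "X = (F \<inter> A) \<union> (\<Union>D\<in>\<D>. Y D)"
  have "Y D \<subseteq> A" if "D \<in> \<D>" for D using Y[OF that] DA[OF that] by blast
  then have X: "X \<subseteq> A" "finite X" using F(1) \<D>(1) Y by (auto simp: X_def)
  obtain D0 where "D0 \<in> \<D>" using \<D>(2) by blast
  then have "Y D0 \<subseteq> X" "card (Y D0) \<ge> 2" using Y by (auto simp: X_def)
  then have "2 \<le> card X" using card_mono[OF X(2)] order_trans by blast
  then obtain c where c: "finite_cycle E c" "set c \<inter> A = X"
    using finite_cycle_through[OF finite_case assms(5) X] by blast
  obtain L :: int and z where L: "L \<ge> 3" and z_eq: "\<And>i j. z i = z j \<longleftrightarrow> L dvd i - j"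
    and z_edge: "\<And>i. {z i, z (i + 1)} \<in> E" and z_range: "range z = set c"
    by (rule finite_cycle_unrolled[OF c(1)]) (rule that)
  have "\<exists>k. z (k - 1) \<in> D \<and> z k \<in> B \<and> z (k + 1) \<in> D" if DD: "D \<in> \<D>" for D
  proof -
    have "Y D \<subseteq> range z" "card F < card (Y D)" "Y D \<subseteq> D"
      using Y[OF DD] DD c(2) z_range by (auto simp: X_def)
    from cycle_stays_in_part[OF bip z_eq z_edge DA[OF DD] F(1) sep[OF _ DD] this(3,1,2)]
    show ?thesis by blast
  qed
  then obtain \<kappa> where \<kappa>: "\<And>D. D \<in> \<D> \<Longrightarrow> z (\<kappa> D - 1) \<in> D" "\<And>D. D \<in> \<D> \<Longrightarrow> z (\<kappa> D) \<in> B"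
      "\<And>D. D \<in> \<D> \<Longrightarrow> z (\<kappa> D + 1) \<in> D"
    by metis
  \<comment> \<open>The rays avoid the rest of the finite cycle, whose vertices in \<open>D\<close>
    are covered already.\<close>
  define good
      where "good = (\<lambda>D R R'. R \<in> rays E \<and> R' \<in> rays E \<and> R 0 = z (\<kappa> D - 1) \<and> R' 0 = z (\<kappa> D + 1) \<and>
      range R \<inter> range R' = {} \<and>
      range R \<union> range R' \<subseteq> hull_in B E D - (set c - {z (\<kappa> D - 1), z (\<kappa> D + 1)}) \<and>
      D - (set c - {z (\<kappa> D - 1), z (\<kappa> D + 1)}) \<subseteq> range R \<union> range R')"
  have "\<exists>R R'. good D R R'" if DD: "D \<in> \<D>" for D
  proof -
    let ?x = "z (\<kappa> D - 1)" and ?y = "z (\<kappa> D + 1)"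
    \<comment> \<open>The two positions differ by 2, which is no multiple of \<open>L\<close>
      because \<open>L\<close> is at least 3.\<close>
    have "\<not> L dvd (\<kappa> D - 1) - (\<kappa> D + 1)" using L zdvd_imp_le[of L 2] by auto
    then have "?x \<noteq> ?y" using z_eq by blast
    moreover have "countable D" using DA[OF DD] assms(2)
        by (meson countable_Un_iff countable_subset)
    moreover have "D \<subseteq> hull_in B E D" by (auto simp: hull_in_def)
    moreover have "?x \<in> D - (set c - {?x, ?y})" "?y \<in> D - (set c - {?x, ?y})" using \<kappa>[OF DD] by auto
    moreover have "finite (set c - {?x, ?y})" by simp
    ultimately obtain R R' where "R \<in> rays E" "R' \<in> rays E" "R 0 = ?x" "R' 0 = ?y"
        "range R \<inter> range R' = {}"
        "range R \<union> range R' \<subseteq> hull_in B E D - (set c - {?x, ?y})"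
            "D - (set c - {?x, ?y}) \<subseteq> range R \<union> range R'"
      using D[OF DD]
          by (elim two_disjoint_rays_covering[of E "hull_in B E D" D "set c - {?x, ?y}" ?x ?y, rotated -1]) blast+
    then show ?thesis unfolding good_def by blast
  qed
  then obtain R R' where "\<And>D. D \<in> \<D> \<Longrightarrow> good D (R D) (R' D)" by metis
  then have rays: "\<And>D. D \<in> \<D> \<Longrightarrow> R D \<in> rays E \<and> R' D \<in> rays E"
    and start: "\<And>D. D \<in> \<D> \<Longrightarrow> R D 0 = z (\<kappa> D - 1)" "\<And>D. D \<in> \<D> \<Longrightarrow> R' D 0 = z (\<kappa> D + 1)"
    and disj: "\<And>D. D \<in> \<D> \<Longrightarrow> range (R D) \<inter> range (R' D) = {}"
    and ran: "\<And>D. D \<in> \<D> \<Longrightarrow>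
        range (R D) \<union> range (R' D) \<subseteq> hull_in B E D - (set c - {z (\<kappa> D - 1), z (\<kappa> D + 1)})"
    and cov: "\<And>D. D \<in> \<D> \<Longrightarrow> D - (set c - {z (\<kappa> D - 1), z (\<kappa> D + 1)}) \<subseteq> range (R D) \<union> range (R' D)"
    unfolding good_def by blast+
  have in_cl: "range (R D) \<subseteq> hull_in B E D" "range (R' D) \<subseteq> hull_in B E D" if "D \<in> \<D>" for D
    using ran[OF that] by blast+
  have "\<exists>Z. is_cycle (A \<union> B) E Z \<and> range z - z ` \<kappa> ` \<D> \<subseteq> fst Z \<and>
      (\<forall>D\<in>\<D>. range (R D) \<union> range (R' D) \<subseteq> fst Z)"
  proof (rule cycle_from_cut_cycle[OF simple _ z_eq z_edge \<D>(1,2) rays start disj])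
    show "L > 0" using L by simp
    show "(range (R D) \<union> range (R' D)) \<inter> range z \<subseteq> {R D 0, R' D 0}" if "D \<in> \<D>" for D
      using ran[OF that] unfolding start[OF that] z_range by (intro subsetI) auto
    show "(range (R D) \<union> range (R' D)) \<inter> (range (R D') \<union> range (R' D')) = {}"
      if "D \<in> \<D>" "D' \<in> \<D>" "D \<noteq> D'" for D D'
      using hull_in_disjoint[OF bip nb_ne DA DA D_disj] in_cl that by blast
    show "D = D'" if "D \<in> \<D>" "D' \<in> \<D>" "L dvd \<kappa> D - \<kappa> D'" for D D'
    proof (rule ccontr)
      assume "D \<noteq> D'"
      moreover have "z (\<kappa> D - 1) = z (\<kappa> D' - 1)" using that(3) by (simp add: z_eq)
      ultimately show False using \<kappa>(1)[OF that(1)] \<kappa>(1)[OF that(2)] D_disj[OF that(1,2)] by auto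
    qed
    show "\<not> L dvd \<kappa> D - \<kappa> D' - 1" if "D \<in> \<D>" "D' \<in> \<D>" for D D'
    proof
      assume "L dvd \<kappa> D - \<kappa> D' - 1"
      \<comment> \<open>Cuts are made at vertices of \<open>B\<close>, while their neighbours on the
        cycle are in \<open>A\<close>.\<close>
      then have "z (\<kappa> D) = z (\<kappa> D' + 1)" by (simp add: z_eq algebra_simps)
      then show False using \<kappa>(2)[OF that(1)] \<kappa>(3)[OF that(2)] DA[OF that(2)] AB by auto
    qed
    show "(R D, R' D) \<in> ray_equiv (A \<union> B) E" if "D \<in> \<D>" for D
      using rays_in_closure_equiv[OF bip DA[OF that]] D[OF that] rays[OF that] in_cl[OF that]
          by blast
    show "finite F" "F \<subseteq> A \<union> B" by (fact F)+
    fix D D' F' assume DD: "D \<in> \<D>" "D' \<in> \<D>" and F': "finite F'" "F \<subseteq> F'" "F' \<subseteq> A \<union> B"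
      and eq: "end_component (A \<union> B) E F' (end_of (A \<union> B) E (R D)) = end_component (A \<union>
          B) E F' (end_of (A \<union> B) E (R D'))"
    define C where "C = end_component (A \<union> B) E F' (end_of (A \<union> B) E (R D))"
    have C: "C \<in> components_minus (A \<union> B) E F'" "has_tail_in (R D) C" "has_tail_in (R D') C"
      using end_component_is_component[OF simple _ F'(1,3), of "R D"]
        end_component_is_component(2)[OF simple _ F'(1,3), of "R D'"]
        rays[OF DD(1)] rays[OF DD(2)]
      unfolding C_def eq[symmetric] by blast+
    obtain k k' where k: "R D ` {k..} \<subseteq> C" "R D' ` {k'..} \<subseteq> C" using C
        by (auto simp: has_tail_in_def)
    obtain n where n: "n \<ge> k" "R D n \<in> D"
      using ray_in_closure_hits[OF bip DA[OF DD(1)] _ in_cl(1)[OF DD(1)]] rays[OF DD(1)] by blast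
    obtain n' where n': "n' \<ge> k'" "R D' n' \<in> D'"
      using ray_in_closure_hits[OF bip DA[OF DD(2)] _ in_cl(1)[OF DD(2)]] rays[OF DD(2)] by blast
    show "D = D'"
    proof (rule ccontr)
      assume "D \<noteq> D'"
      show False
        by (rule separated_parts[OF bip DA[OF DD(1)] DA[OF DD(2)] D_disj[OF DD \<open>D \<noteq> D'\<close>]
            sep[OF _ DD(1)] C(1) F'(2) _ n(2) _ n'(2)])
          (use k n n' in auto)
    qed
  qed
  then obtain Z where Z: "is_cycle (A \<union> B) E Z" "range z - z ` \<kappa> ` \<D> \<subseteq> fst Z"
    "\<And>D. D \<in> \<D> \<Longrightarrow> range (R D) \<union> range (R' D) \<subseteq> fst Z" by blast
  have "a \<in> fst Z" if a: "a \<in> A" for a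
  proof (cases "a \<in> set c")
    case True
    \<comment> \<open>The only vertices of the finite cycle that are given up lie in
      \<open>B\<close>.\<close>
    moreover have "a \<notin> z ` \<kappa> ` \<D>" using a \<kappa>(2) AB by blast
    ultimately show ?thesis using Z(2) z_range by blast
  next
    case False
    then have "a \<notin> F" using a c(2) by (auto simp: X_def)
    then obtain D where "D \<in> \<D>" "a \<in> D" using a \<D>(4) by blast
    then show ?thesis using cov[of D] Z(3)[of D] False by blast
  qed
  then show ?thesis using Z(1) by blast
qed

end
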